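(* Let $F$ be a field and let $H$ be a finite group whose order is not divisible by the characteristic of $F$. The following conditions are equivalent. (i) $H$ has a faithful irreducible representation over $F$. (ii) For any injective homomorphism $\iota\colon H\to G$ to a finite group $G$ whose order is not divisible by the characteristic of $F$, the group $G$ has an irreducible representation $\sigma$ over $F$ such that $\sigma\circ\iota$ is injective and $\sigma$ is center-preserving on $\iota(H)$.
   Context: All representations are finite-dimensional linear representations over $F$. For a group $L$, $\mathrm{Z}(L)$ denotes its center. For a group homomorphism $\sigma\colon G\to L$ (in particular a representation), the center of $\sigma$ is $\mathrm{Z}(\sigma)=\sigma^{-1}\big(\mathrm{Z}(\sigma(G))\big)$. For a subgroup $K\leq G$, $\sigma$ is called center-preserving on $K$ if $\mathrm{Z}(\sigma)\cap K\leq \mathrm{Z}(G)$. *)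

theory Defs
  imports "Jordan_Normal_Form.VS_Connect"
begin

text \<open>Every finite-dimensional space over the field \<open>'f\<close> is isomorphic to some \<open>F\<^sup>n\<close>, realised
  as \<^term>\<open>carrier_vec n\<close>; a finite-dimensional representation is a homomorphism into
  \<open>GL\<^sub>n(F)\<close>, for some \<open>n\<close>.\<close>

definition GL :: "'f::field itself \<Rightarrow> nat \<Rightarrow> 'f mat monoid" where
  "GL ty n = units_of (ring_mat ty n ())"

definition representation ::
    "('g, 'm) monoid_scheme \<Rightarrow> nat \<Rightarrow> ('g \<Rightarrow> 'f::field mat) \<Rightarrow> bool" where
  "representation G n \<sigma> \<longleftrightarrow> \<sigma> \<in> hom G (GL TYPE('f) n)"

text \<open>The zero representation (\<open>n = 0\<close>) is not irreducible.\<close>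

definition irreducible_representation ::
    "('g, 'm) monoid_scheme \<Rightarrow> nat \<Rightarrow> ('g \<Rightarrow> 'f::field mat) \<Rightarrow> bool" where
  "irreducible_representation G n \<sigma> \<longleftrightarrow>
     representation G n \<sigma> \<and> n > 0 \<and>
     (\<forall>W. VectorSpace.subspace class_ring W (module_vec TYPE('f) n) \<longrightarrow>
          (\<forall>g\<in>carrier G. \<forall>w\<in>W. \<sigma> g *\<^sub>v w \<in> W) \<longrightarrow>
          W = {0\<^sub>v n} \<or> W = carrier_vec n)"

definition center :: "('l, 'm) monoid_scheme \<Rightarrow> 'l set" where
  "center L = {z \<in> carrier L. \<forall>x\<in>carrier L. z \<otimes>\<^bsub>L\<^esub> x = x \<otimes>\<^bsub>L\<^esub> z}"

definition hom_center ::
    "('g, 'm) monoid_scheme \<Rightarrow> ('l, 'k) monoid_scheme \<Rightarrow> ('g \<Rightarrow> 'l) \<Rightarrow> 'g set" where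
  "hom_center G L \<sigma> = {g \<in> carrier G. \<sigma> g \<in> center (L\<lparr>carrier := \<sigma> ` carrier G\<rparr>)}"

definition center_preserving_on ::
    "('g, 'm) monoid_scheme \<Rightarrow> ('l, 'k) monoid_scheme \<Rightarrow> ('g \<Rightarrow> 'l) \<Rightarrow> 'g set \<Rightarrow> bool" where
  "center_preserving_on G L \<sigma> K \<longleftrightarrow> hom_center G L \<sigma> \<inter> K \<subseteq> center G"

text \<open>A formula cannot quantify over types, so statements of the form ``for every finite group
  \<open>G\<close>'' let \<open>G\<close> range over the groups with carrier in a type \<open>'g\<close> that is assumed infinite:
  then every finite group is isomorphic to such a \<open>G\<close>.  The condition
  \<open>\<not> CHAR('f) dvd Coset.order G\<close> is vacuous in characteristic zero, as \<open>0\<close> divides only \<open>0\<close> and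
  finite groups have positive order.\<close>

end

theory Submission
  imports Defs "HOL-Library.Function_Algebras" "HOL-Algebra.Weak_Morphisms" "HOL-Algebra.Zassenhaus"
    "HOL-Algebra.Generated_Groups" "HOL-Algebra.Multiplicative_Group"
begin

text \<open>For (ii) \<open>\<Longrightarrow>\<close> (i), apply (ii) to an isomorphism from \<open>H\<close> onto a group \<open>G\<close> with carrier in \<open>'g\<close>.

  For (i) \<open>\<Longrightarrow>\<close> (ii), identify \<open>H\<close> with its image \<open>K\<close> in \<open>G\<close> and let \<open>\<rho>\<close> be a faithful irreducible
  representation of \<open>K\<close>.  Among the normal subgroups \<open>R\<close> of \<open>G\<close> that meet \<open>K\<close> trivially, and modulo
  which no element of \<open>K\<close> outside the center of \<open>G\<close> becomes central, take a maximal one.  It suffices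
  that \<open>G/R\<close> has a faithful irreducible representation: pulled back to \<open>G\<close>, it is injective on \<open>K\<close>,
  and an element of \<open>K\<close> with central image is central modulo \<open>R\<close>, hence central in \<open>G\<close>
  (\<open>center_preserving_extension\<close>).  So replace \<open>G\<close> by \<open>G/R\<close>.  By maximality, every nontrivial normal
  subgroup \<open>M\<close> with \<open>M \<inter> K = 1\<close> now has a witness: some \<open>z \<in> K\<close> that is not central in \<open>G\<close>
  but is central modulo \<open>M\<close>; a suitable power of \<open>z\<close> is a witness of prime power order.

  A constituent of the representation induced from \<open>\<rho>\<close> restricts to \<open>K\<close> with \<open>\<rho>\<close> as a quotient, so
  its kernel meets \<open>K\<close> trivially.  It is therefore faithful as soon as it is nontrivial on every
  minimal normal subgroup \<open>M\<close> with \<open>M \<inter> K = 1\<close>; these are the obstructions.  The sum of the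
  constituents on which \<open>M\<close> acts nontrivially is the set of functions whose sum over each coset of
  \<open>M\<close> vanishes, so a nonzero function in the induced representation is needed that has this property
  for all obstructions at once.  Subtracting from a function \<open>f\<close> its average over \<open>M\<close> gives the
  property for \<open>M\<close> and keeps it for the other obstructions; the result is nonzero if \<open>f\<close> is
  supported in a subgroup that does not contain \<open>M\<close>.  Starting from a function supported in \<open>K\<close>,
  this succeeds if the obstructions can be ordered so that none is contained in the subgroup
  generated by \<open>K\<close> and the earlier ones (\<open>induced_vector_off_obstructions\<close>).

  Such an order exists (\<open>independent_obstruction\<close>) because the witness of \<open>M\<close> commutes with \<open>K\<close> and
  with all other obstructions.  If it does not commute with \<open>M\<close>, then \<open>M\<close> is not in the subgroup
  generated by \<open>K\<close> and the others, which centralizes the witness.  If it does, then \<open>M\<close> is abelian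
  of exponent dividing the order of the witness, a prime power; obstructions of this kind are put
  first, and their primes are distinct.  Here the representation theory of \<open>K\<close> enters: as \<open>\<rho>\<close> is
  faithful and irreducible, of two central elements of \<open>K\<close> of \<open>p\<close>-power order one is a
  power of the other (\<open>central_p_elements_comparable\<close>), while witnesses of distinct obstructions are
  never powers of each other.\<close>

section \<open>Matrix representations from linear actions\<close>

lemma subspace_vec_iff:
  fixes W :: "'f::field vec set"
  shows "VectorSpace.subspace class_ring W (module_vec TYPE('f) n) \<longleftrightarrow>
    W \<subseteq> carrier_vec n \<and> 0\<^sub>v n \<in> W \<and> (\<forall>v\<in>W. \<forall>w\<in>W. v + w \<in> W) \<and> (\<forall>c. \<forall>w\<in>W. c \<cdot>\<^sub>v w \<in> W)"
proof -
  interpret vec_space "TYPE('f)" n .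
  show ?thesis
    unfolding VectorSpace.subspace_def submodule_def using vec_vs vec_module
    by (auto simp: module_vec_def)
qed

lemma representation_iff:
  fixes G (structure) and \<sigma> :: "'g \<Rightarrow> 'f::field mat"
  assumes "group G"
  shows "representation G n \<sigma> \<longleftrightarrow> (\<forall>g\<in>carrier G. \<sigma> g \<in> carrier_mat n n) \<and> \<sigma> \<one>\<^bsub>G\<^esub> = 1\<^sub>m n \<and>
    (\<forall>g\<in>carrier G. \<forall>h\<in>carrier G. \<sigma> (g \<otimes>\<^bsub>G\<^esub> h) = \<sigma> g * \<sigma> h)"
proof -
  interpret group G by fact
  interpret M: ring "ring_mat TYPE('f) n ()" by (rule ring_mat)
  have gl: "group (GL TYPE('f) n)" unfolding GL_def by (rule M.units_group)
  show ?thesis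
  proof
    assume "representation G n \<sigma>"
    then have h: "\<sigma> \<in> hom G (GL TYPE('f) n)" by (simp add: representation_def)
    interpret group_hom G "GL TYPE('f) n" \<sigma>
      using gl h by (simp add: group_hom_def group_hom_axioms_def group_axioms)
    show "(\<forall>g\<in>carrier G. \<sigma> g \<in> carrier_mat n n) \<and> \<sigma> \<one> = 1\<^sub>m n \<and>
      (\<forall>g\<in>carrier G. \<forall>h\<in>carrier G. \<sigma> (g \<otimes> h) = \<sigma> g * \<sigma> h)"
      using hom_closed hom_one hom_mult
      by (auto simp: GL_def units_of_def Units_def ring_mat_simps)
  next
    assume r: "(\<forall>g\<in>carrier G. \<sigma> g \<in> carrier_mat n n) \<and> \<sigma> \<one> = 1\<^sub>m n \<and>
      (\<forall>g\<in>carrier G. \<forall>h\<in>carrier G. \<sigma> (g \<otimes> h) = \<sigma> g * \<sigma> h)"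
    have "\<sigma> g \<in> Units (ring_mat TYPE('f) n ())" if g: "g \<in> carrier G" for g
    proof -
      have "\<sigma> g * \<sigma> (inv g) = 1\<^sub>m n" "\<sigma> (inv g) * \<sigma> g = 1\<^sub>m n"
        using r g by (metis inv_closed r_inv, metis inv_closed l_inv)
      then show ?thesis using r g unfolding Units_def by (auto simp: ring_mat_simps)
    qed
    then show "representation G n \<sigma>"
      using r by (auto simp: representation_def hom_def GL_def units_of_def ring_mat_simps)
  qed
qed

lemma irreducible_representation_pullback:
  assumes A: "group A" and B: "group B" and f: "f \<in> hom A B" "f ` carrier A = carrier B"
    and \<sigma>: "irreducible_representation B n \<sigma>"
  shows "irreducible_representation A n (\<sigma> \<circ> f)"
proof -
  have "representation A n (\<sigma> \<circ> f)"
    using \<sigma> f hom_compose[OF f(1)] by (auto simp: irreducible_representation_def representation_def)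
  moreover have "\<forall>g\<in>carrier B. \<forall>w\<in>W. \<sigma> g *\<^sub>v w \<in> W"
    if "\<forall>g\<in>carrier A. \<forall>w\<in>W. (\<sigma> \<circ> f) g *\<^sub>v w \<in> W" for W
    using that unfolding f(2)[symmetric] by auto
  ultimately show ?thesis using \<sigma> unfolding irreducible_representation_def by blast
qed

lemma eq_mat_by_action:
  fixes A B :: "'f::field mat"
  assumes A: "A \<in> carrier_mat n n" and B: "B \<in> carrier_mat n n"
    and eq: "\<And>w. w \<in> carrier_vec n \<Longrightarrow> A *\<^sub>v w = B *\<^sub>v w"
  shows "A = B"
proof (rule eq_matI)
  fix i j assume ij: "i < dim_row B" "j < dim_col B"
  have "(A *\<^sub>v unit_vec n j) $ i = A $$ (i,j)" "(B *\<^sub>v unit_vec n j) $ i = B $$ (i,j)"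
    using A B ij by (auto simp: scalar_prod_right_unit)
  then show "A $$ (i,j) = B $$ (i,j)" using eq[of "unit_vec n j"] by simp
qed (use A B in auto)

definition invariant_under :: "('g, 'm) monoid_scheme \<Rightarrow> ('g \<Rightarrow> 'b \<Rightarrow> 'b) \<Rightarrow> 'b set \<Rightarrow> bool" where
  "invariant_under G T W \<longleftrightarrow> (\<forall>g\<in>carrier G. \<forall>x\<in>W. T g x \<in> W)"

text \<open>Only the behaviour on \<open>W\<close> matters, so that an action passes to invariant subspaces without change
  of the maps \<open>T g\<close>.\<close>

definition acts_on :: "('a::field \<Rightarrow> 'b::ab_group_add \<Rightarrow> 'b) \<Rightarrow>
    ('g, 'm) monoid_scheme \<Rightarrow> ('g \<Rightarrow> 'b \<Rightarrow> 'b) \<Rightarrow> 'b set \<Rightarrow> bool" where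
  "acts_on scale G T W \<longleftrightarrow> Modules.module.subspace scale W \<and> invariant_under G T W \<and>
     (\<forall>x\<in>W. T \<one>\<^bsub>G\<^esub> x = x) \<and>
     (\<forall>g\<in>carrier G. \<forall>h\<in>carrier G. \<forall>x\<in>W. T (g \<otimes>\<^bsub>G\<^esub> h) x = T g (T h x)) \<and>
     (\<forall>g\<in>carrier G. \<forall>x\<in>W. \<forall>y\<in>W. T g (x + y) = T g x + T g y) \<and>
     (\<forall>g\<in>carrier G. \<forall>c. \<forall>x\<in>W. T g (scale c x) = scale c (T g x))"

definition irreducible_action :: "('a::field \<Rightarrow> 'b::ab_group_add \<Rightarrow> 'b) \<Rightarrow>
    ('g, 'm) monoid_scheme \<Rightarrow> ('g \<Rightarrow> 'b \<Rightarrow> 'b) \<Rightarrow> 'b set \<Rightarrow> bool" where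
  "irreducible_action scale G T W \<longleftrightarrow> acts_on scale G T W \<and> W \<noteq> {0} \<and>
     (\<forall>U. Modules.module.subspace scale U \<longrightarrow> U \<subseteq> W \<longrightarrow> invariant_under G T U \<longrightarrow> U = {0} \<or> U = W)"

context vector_space
begin

lemma acts_on_sub: "acts_on scale G T V \<Longrightarrow> W \<subseteq> V \<Longrightarrow> subspace W \<Longrightarrow> invariant_under G T W \<Longrightarrow> acts_on scale G T W"
  unfolding acts_on_def by blast

text \<open>An invariant nonzero subspace of least dimension is irreducible.  The ambient space may be
  infinite-dimensional, so proper inclusion is turned into strict inequality of dimensions by
  extending a basis.\<close>

lemma irreducible_subaction:
  assumes V: "acts_on scale G T V" "V \<noteq> {0}" and fin: "finite S" "V \<subseteq> span S"
  obtains W where "W \<subseteq> V" "irreducible_action scale G T W"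
proof -
  define C where "C = {W. W \<subseteq> V \<and> W \<noteq> {0} \<and> subspace W \<and> invariant_under G T W}"
  have "V \<in> C" using V by (auto simp: C_def acts_on_def)
  then obtain W where W: "W \<in> C" and min: "\<And>U. U \<in> C \<Longrightarrow> dim W \<le> dim U"
    using arg_min_natI[of "\<lambda>W. W \<in> C" V dim] arg_min_nat_le[of "\<lambda>W. W \<in> C" _ dim] by blast
  have "U = W" if U: "subspace U" "U \<subseteq> W" "invariant_under G T U" "U \<noteq> {0}" for U
  proof (rule ccontr)
    assume ne: "U \<noteq> W"
    obtain A where A: "A \<subseteq> U" "independent A" "U \<subseteq> span A"
      using maximal_independent_subset by blast
    obtain B where B: "A \<subseteq> B" "B \<subseteq> W" "independent B" "W \<subseteq> span B"
      using maximal_independent_subset_extend[of A W] A U by blast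
    have "finite B" using independent_span_bound[OF fin(1) B(3)] B(2) W fin(2) by (auto simp: C_def)
    moreover have "A \<noteq> B"
    proof
      assume "A = B"
      then have "W \<subseteq> U" using B(4) A(1) U(1) span_minimal by blast
      then show False using ne U(2) by blast
    qed
    ultimately have "card A < card B" using B(1) by (simp add: psubset_card_mono psubsetI)
    moreover have "dim U = card A" "dim W = card B"
      using basis_card_eq_dim A B by metis+
    moreover have "U \<in> C" using U W by (auto simp: C_def)
    ultimately show False using min[of U] by simp
  qed
  then have "irreducible_action scale G T W"
    using W acts_on_sub[OF V(1)] by (auto simp: irreducible_action_def C_def)
  then show ?thesis using that W by (auto simp: C_def)
qed

lemma acts_on_sum:
  assumes a: "acts_on scale G T W" and g: "g \<in> carrier G" and f: "finite A" "\<And>i. i \<in> A \<Longrightarrow> b i \<in> W"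
  shows "T g (\<Sum>i\<in>A. scale (c i) (b i)) = (\<Sum>i\<in>A. scale (c i) (T g (b i)))"
  using f
proof (induction A rule: finite_induct)
  case empty
  have "0 \<in> W" using a by (simp add: acts_on_def subspace_0)
  then have "T g (scale 0 0) = scale 0 (T g 0)" using a g unfolding acts_on_def by blast
  then show ?case by simp
next
  case (insert i A)
  have sW: "subspace W" using a by (simp add: acts_on_def)
  have 1: "scale (c i) (b i) \<in> W" using insert sW by (simp add: subspace_scale)
  have 2: "(\<Sum>i\<in>A. scale (c i) (b i)) \<in> W"
    using insert sW by (intro subspace_sum) (auto intro: subspace_scale)
  have "T g (scale (c i) (b i)) = scale (c i) (T g (b i))"
    using a g insert by (simp add: acts_on_def)
  moreover have "T g (scale (c i) (b i) + (\<Sum>i\<in>A. scale (c i) (b i))) =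
     T g (scale (c i) (b i)) + T g (\<Sum>i\<in>A. scale (c i) (b i))"
    using a g 1 2 unfolding acts_on_def by blast
  ultimately show ?case using insert by simp
qed

text \<open>In coordinates with respect to a basis of \<open>W\<close>, the action becomes a matrix representation; the
  coordinate isomorphism matches invariant subspaces on both sides, and equal matrices come from maps
  that agree on \<open>W\<close>.\<close>

lemma matrix_realization:
  fixes G (structure)
  assumes G: "group G" and irr: "irreducible_action scale G T W" and fin: "finite S" "W \<subseteq> span S"
  obtains n \<tau> where "irreducible_representation G n (\<tau> :: 'g \<Rightarrow> 'a mat)"
    and "\<And>g h x. \<lbrakk>g \<in> carrier G; h \<in> carrier G; \<tau> g = \<tau> h; x \<in> W\<rbrakk> \<Longrightarrow> T g x = T h x"
proof -
  interpret group G by fact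
  have act: "acts_on scale G T W" and W: "subspace W" "W \<noteq> {0}"
    using irr by (auto simp: irreducible_action_def acts_on_def)
  have inW: "T g x \<in> W" if "g \<in> carrier G" "x \<in> W" for g x
    using act that by (simp add: acts_on_def invariant_under_def)
  obtain B where B: "B \<subseteq> W" "independent B" "W \<subseteq> span B"
    using maximal_independent_subset by blast
  have finB: "finite B" using independent_span_bound[OF fin(1) B(2)] B(1) fin(2) by auto
  define n where "n = card B"
  obtain b where b: "bij_betw b {..<n} B"
    using finB ex_bij_betw_nat_finite[of B] unfolding n_def by (auto simp: lessThan_atLeast0)
  have bW: "b j \<in> W" if "j < n" for j using b B(1) that by (auto simp: bij_betw_def)
  \<comment> \<open>The two directions of the coordinate isomorphism between \<open>F\<^sup>n\<close> and \<open>W\<close>.\<close>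
  define c where "c w = (\<Sum>j<n. scale (w $ j) (b j))" for w :: "'a vec"
  define d where "d x = vec n (\<lambda>j. representation B x (b j))" for x
  have cd: "c (d x) = x" if "x \<in> W" for x
  proof -
    have "c (d x) = (\<Sum>j<n. scale (representation B x (b j)) (b j))"
      by (simp add: c_def d_def)
    also have "\<dots> = (\<Sum>v\<in>B. scale (representation B x v) v)"
      using sum.reindex_bij_betw[OF b, of "\<lambda>v. scale (representation B x v) v"] by simp
    also have "\<dots> = x" using B finB that by (intro sum_representation_eq) auto
    finally show ?thesis .
  qed
  have dn: "d x \<in> carrier_vec n" for x by (simp add: d_def)
  have cW: "c w \<in> W" for w
    unfolding c_def using bW W(1) by (intro subspace_sum subspace_scale) auto
  have c_add: "c (v + w) = c v + c w" if "v \<in> carrier_vec n" "w \<in> carrier_vec n" for v w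
    using that by (simp add: c_def scale_left_distrib sum.distrib)
  have c_smult: "c (a \<cdot>\<^sub>v w) = scale a (c w)" if "w \<in> carrier_vec n" for a w
    using that by (simp add: c_def scale_sum_right)
  have c_zero: "w = 0\<^sub>v n" if w: "w \<in> carrier_vec n" "c w = 0" for w
  proof -
    define u where "u v = w $ (inv_into {..<n} b v)" for v
    have "(\<Sum>v\<in>B. scale (u v) v) = (\<Sum>j<n. scale (u (b j)) (b j))"
      using sum.reindex_bij_betw[OF b, of "\<lambda>v. scale (u v) v"] by simp
    also have "\<dots> = c w" unfolding c_def u_def
      using b by (intro sum.cong refl) (simp add: bij_betw_def)
    finally have "(\<Sum>v\<in>B. scale (u v) v) = 0" using w(2) by simp
    then have "\<forall>v\<in>B. u v = 0"
      using B(2) finB independent_explicit_finite_subsets[of B] by (meson subset_refl)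
    then have "w $ j = 0" if "j < n" for j
      using that b by (force simp: u_def bij_betw_def)
    then show ?thesis using w by auto
  qed
  have c_inj: "v = w" if vw: "v \<in> carrier_vec n" "w \<in> carrier_vec n" "c v = c w" for v w
  proof -
    have "c (v + (-1) \<cdot>\<^sub>v w) = c v + scale (-1) (c w)"
      using vw by (subst c_add) (auto simp: c_smult)
    then have "c (v + (-1) \<cdot>\<^sub>v w) = 0" using vw by simp
    then have "v + (-1) \<cdot>\<^sub>v w = 0\<^sub>v n" using vw by (intro c_zero) auto
    show ?thesis
    proof (rule eq_vecI)
      fix i assume i: "i < dim_vec w"
      have "(v + (-1) \<cdot>\<^sub>v w) $ i = 0"
        using \<open>v + (-1) \<cdot>\<^sub>v w = 0\<^sub>v n\<close> i vw by simp
      then show "v $ i = w $ i" using i vw by simp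
    qed (use vw in auto)
  qed
  have c0: "c (0\<^sub>v n) = 0" by (simp add: c_def)
  define \<tau> where "\<tau> g = mat n n (\<lambda>(i,j). representation B (T g (b j)) (b i))" for g
  have \<tau>c: "\<tau> g \<in> carrier_mat n n" for g by (simp add: \<tau>_def)
  have \<tau>: "c (\<tau> g *\<^sub>v w) = T g (c w)" if g: "g \<in> carrier G" and w: "w \<in> carrier_vec n" for g w
  proof -
    have "c (\<tau> g *\<^sub>v w) = (\<Sum>i<n. scale (\<Sum>j<n. representation B (T g (b j)) (b i) * w $ j) (b i))"
      unfolding c_def using w
      by (intro sum.cong refl)
        (auto simp: \<tau>_def scalar_prod_def lessThan_atLeast0 intro!: sum.cong arg_cong2[where f=scale])
    also have "\<dots> = (\<Sum>i<n. \<Sum>j<n. scale (w $ j) (scale (representation B (T g (b j)) (b i)) (b i)))"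
      by (simp add: scale_sum_left mult.commute)
    also have "\<dots> = (\<Sum>j<n. scale (w $ j) (c (d (T g (b j)))))"
      by (subst sum.swap) (simp add: c_def d_def scale_sum_right)
    also have "\<dots> = (\<Sum>j<n. scale (w $ j) (T g (b j)))"
      using cd inW bW g by (intro sum.cong refl) auto
    also have "\<dots> = T g (c w)"
      unfolding c_def using bW by (intro acts_on_sum[OF act g, symmetric]) auto
    finally show ?thesis .
  qed
  have \<tau>m: "\<tau> g *\<^sub>v w \<in> carrier_vec n" if "w \<in> carrier_vec n" for g w
    using mult_mat_vec_carrier[OF \<tau>c that] .
  have "Defs.representation G n \<tau>"
    unfolding representation_iff[OF G]
  proof (intro conjI ballI)
    show "\<tau> \<one> = 1\<^sub>m n"
    proof (rule eq_mat_by_action[OF \<tau>c])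
      fix w :: "'a vec" assume w: "w \<in> carrier_vec n"
      have "c (\<tau> \<one> *\<^sub>v w) = c w" using \<tau> w act cW by (simp add: acts_on_def)
      then show "\<tau> \<one> *\<^sub>v w = 1\<^sub>m n *\<^sub>v w" using c_inj \<tau>m w by simp
    qed simp
  next
    fix g h assume g: "g \<in> carrier G" and h: "h \<in> carrier G"
    show "\<tau> (g \<otimes> h) = \<tau> g * \<tau> h"
    proof (rule eq_mat_by_action[OF \<tau>c])
      show "\<tau> g * \<tau> h \<in> carrier_mat n n" by (rule mult_carrier_mat[OF \<tau>c \<tau>c])
      fix w :: "'a vec" assume w: "w \<in> carrier_vec n"
      have "T (g \<otimes> h) (c w) = T g (T h (c w))" using act g h cW by (simp add: acts_on_def)
      then have "c (\<tau> (g \<otimes> h) *\<^sub>v w) = c (\<tau> g *\<^sub>v (\<tau> h *\<^sub>v w))"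
        using \<tau> g h w \<tau>m by simp
      then show "\<tau> (g \<otimes> h) *\<^sub>v w = (\<tau> g * \<tau> h) *\<^sub>v w"
        using c_inj \<tau>m w by (simp add: assoc_mult_mat_vec[OF \<tau>c \<tau>c w])
    qed
  qed (rule \<tau>c)
  moreover have "n > 0"
  proof (rule ccontr)
    assume "\<not> n > 0"
    then have "B = {}" using finB by (simp add: n_def)
    then have "W \<subseteq> {0}" using B(3) by simp
    moreover have "0 \<in> W" using W(1) by (rule subspace_0)
    ultimately show False using W(2) by blast
  qed
  moreover have "U = {0\<^sub>v n} \<or> U = carrier_vec n"
    if "VectorSpace.subspace class_ring U (module_vec TYPE('a) n)"
      and inv: "\<forall>g\<in>carrier G. \<forall>w\<in>U. \<tau> g *\<^sub>v w \<in> U" for U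
  proof -
    have U: "U \<subseteq> carrier_vec n" "0\<^sub>v n \<in> U" "\<And>v w. v \<in> U \<Longrightarrow> w \<in> U \<Longrightarrow> v + w \<in> U"
      "\<And>a w. w \<in> U \<Longrightarrow> a \<cdot>\<^sub>v w \<in> U"
      using that(1) by (auto simp: subspace_vec_iff)
    have "subspace (c ` U)"
    proof (rule subspaceI)
      show "0 \<in> c ` U" using U(2) c0 by (metis imageI)
    next
      fix x y assume "x \<in> c ` U" "y \<in> c ` U"
      then show "x + y \<in> c ` U" using U c_add by (auto simp: image_iff) (metis subsetD)
    next
      fix a x assume "x \<in> c ` U"
      then show "scale a x \<in> c ` U" using U c_smult by (auto simp: image_iff) (metis subsetD)
    qed
    moreover have "c ` U \<subseteq> W" using cW by auto
    moreover have "invariant_under G T (c ` U)"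
      unfolding invariant_under_def
    proof (intro ballI)
      fix g x assume g: "g \<in> carrier G" and "x \<in> c ` U"
      then obtain w where w: "w \<in> U" "x = c w" by auto
      then have "T g x = c (\<tau> g *\<^sub>v w)" using \<tau> g U(1) by auto
      then show "T g x \<in> c ` U" using inv g w by auto
    qed
    ultimately have "c ` U = {0} \<or> c ` U = W" using irr unfolding irreducible_action_def by blast
    then show ?thesis
    proof
      assume "c ` U = {0}"
      then have "U \<subseteq> {0\<^sub>v n}" using c_zero U(1) by blast
      then show ?thesis using U(2) by blast
    next
      assume cU: "c ` U = W"
      have "w \<in> U" if w: "w \<in> carrier_vec n" for w
      proof -
        have "c w \<in> c ` U" using cU cW by simp
        then obtain v where "v \<in> U" "c w = c v" by auto
        then show ?thesis using c_inj w U(1) by (metis subsetD)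
      qed
      then show ?thesis using U(1) by blast
    qed
  qed
  ultimately have "irreducible_representation G n \<tau>"
    unfolding irreducible_representation_def by blast
  moreover have "T g x = T h x"
    if "g \<in> carrier G" "h \<in> carrier G" "\<tau> g = \<tau> h" "x \<in> W" for g h x
    using \<tau>[OF that(1) dn, of x] \<tau>[OF that(2) dn, of x] that cd by simp
  ultimately show ?thesis using that by blast
qed

end

section \<open>Normal subgroups and elements central modulo them\<close>

text \<open>For normal \<open>M\<close>: the image of \<open>z\<close> in the quotient by \<open>M\<close> is central.\<close>

definition (in group) central_mod :: "'a set \<Rightarrow> 'a \<Rightarrow> bool" where
  "central_mod M z \<longleftrightarrow> z \<in> carrier G \<and> (\<forall>g\<in>carrier G. g \<otimes> z \<otimes> inv g \<otimes> inv z \<in> M)"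

definition (in group) minimal_normal :: "'a set \<Rightarrow> bool" where
  "minimal_normal M \<longleftrightarrow> M \<lhd> G \<and> M \<noteq> {\<one>} \<and> (\<forall>N. N \<lhd> G \<longrightarrow> N \<subseteq> M \<longrightarrow> N \<noteq> {\<one>} \<longrightarrow> N = M)"

context group
begin

lemma commutator_one_iff:
  assumes "x \<in> carrier G" "y \<in> carrier G"
  shows "x \<otimes> y \<otimes> inv x \<otimes> inv y = \<one> \<longleftrightarrow> x \<otimes> y = y \<otimes> x"
proof -
  have "x \<otimes> y \<otimes> inv x \<otimes> inv y = \<one> \<longleftrightarrow> x \<otimes> y \<otimes> inv x = y"
    using assms by (metis inv_closed inv_equality inv_inv m_closed r_inv)
  also have "\<dots> \<longleftrightarrow> x \<otimes> y = y \<otimes> x"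
    using assms by (metis inv_solve_right' m_closed)
  finally show ?thesis .
qed

lemma in_center_iff: "z \<in> center G \<longleftrightarrow> central_mod {\<one>} z"
  unfolding center_def central_mod_def using commutator_one_iff by force

lemma cancel_inv_left: "x \<in> carrier G \<Longrightarrow> y \<in> carrier G \<Longrightarrow> inv x \<otimes> (x \<otimes> y) = y"
  by (simp add: m_assoc[symmetric])

lemma conj_nat_pow:
  assumes "g \<in> carrier G" "y \<in> carrier G"
  shows "(g \<otimes> y \<otimes> inv g) [^] (k::nat) = g \<otimes> y [^] k \<otimes> inv g"
  using assms by (induction k) (auto simp: m_assoc cancel_inv_left)

lemma inv_commute:
  assumes "x \<otimes> s = s \<otimes> x" "x \<in> carrier G" "s \<in> carrier G"
  shows "inv x \<otimes> s = s \<otimes> inv x"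
proof -
  have "inv x \<otimes> s = inv x \<otimes> (s \<otimes> x) \<otimes> inv x" using assms(2,3) by (simp add: m_assoc)
  also have "\<dots> = inv x \<otimes> (x \<otimes> s) \<otimes> inv x" using assms(1) by simp
  also have "\<dots> = s \<otimes> inv x" using assms(2,3) by (simp add: m_assoc[symmetric])
  finally show ?thesis .
qed

lemma centralizer_subgroup:
  assumes "S \<subseteq> carrier G"
  shows "subgroup {x \<in> carrier G. \<forall>s\<in>S. x \<otimes> s = s \<otimes> x} G"
proof (rule subgroupI)
  fix x y assume x: "x \<in> {x \<in> carrier G. \<forall>s\<in>S. x \<otimes> s = s \<otimes> x}" 
  show "inv x \<in> {x \<in> carrier G. \<forall>s\<in>S. x \<otimes> s = s \<otimes> x}"
    using x assms inv_commute by (auto simp: subset_iff)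
  assume y: "y \<in> {x \<in> carrier G. \<forall>s\<in>S. x \<otimes> s = s \<otimes> x}"
  show "x \<otimes> y \<in> {x \<in> carrier G. \<forall>s\<in>S. x \<otimes> s = s \<otimes> x}"
    using x y assms by (auto simp: subset_iff) (metis m_assoc)
next
  have "\<one> \<in> {x \<in> carrier G. \<forall>s\<in>S. x \<otimes> s = s \<otimes> x}" using assms by auto
  then show "{x \<in> carrier G. \<forall>s\<in>S. x \<otimes> s = s \<otimes> x} \<noteq> {}" by blast
qed auto

lemma subgroup_nat_pow_closed: "subgroup H G \<Longrightarrow> x \<in> H \<Longrightarrow> x [^] (k::nat) \<in> H"
  by (induction k) (auto simp: subgroup.one_closed subgroup.m_closed)

text \<open>The double centralizer argument: \<open>S\<close> lies in its own centralizer, hence so does the generated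
  subgroup, which then centralizes itself.\<close>

lemma generate_commute:
  assumes S: "S \<subseteq> carrier G" and c: "\<And>s t. s \<in> S \<Longrightarrow> t \<in> S \<Longrightarrow> s \<otimes> t = t \<otimes> s"
    and x: "x \<in> generate G S" and y: "y \<in> generate G S"
  shows "x \<otimes> y = y \<otimes> x"
proof -
  have "S \<subseteq> {x \<in> carrier G. \<forall>s\<in>S. x \<otimes> s = s \<otimes> x}" using S c by auto
  from generate_subgroup_incl[OF this centralizer_subgroup[OF S]]
  have 1: "x \<otimes> s = s \<otimes> x" if "x \<in> generate G S" "s \<in> S" for x s using that by auto
  have g: "generate G S \<subseteq> carrier G" using generate_incl[OF S] .
  have "S \<subseteq> {x \<in> carrier G. \<forall>s\<in>generate G S. x \<otimes> s = s \<otimes> x}" using S 1 by auto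
  from generate_subgroup_incl[OF this centralizer_subgroup[OF g]]
  show ?thesis using x y by auto
qed

lemma central_mod_subgroup:
  assumes M: "M \<lhd> G"
  shows "subgroup {z. central_mod M z} G"
proof -
  have sM: "subgroup M G" and cM: "\<And>x h. x \<in> carrier G \<Longrightarrow> h \<in> M \<Longrightarrow> x \<otimes> h \<otimes> inv x \<in> M"
    using M normal_invE by auto
  show ?thesis
  proof (rule subgroupI)
    show "{z. central_mod M z} \<subseteq> carrier G" by (auto simp: central_mod_def)
    have "central_mod M \<one>" using sM by (simp add: central_mod_def subgroup.one_closed)
    then show "{z. central_mod M z} \<noteq> {}" by blast
  next
    fix x assume "x \<in> {z. central_mod M z}"
    then have x: "x \<in> carrier G" "\<And>g. g \<in> carrier G \<Longrightarrow> g \<otimes> x \<otimes> inv g \<otimes> inv x \<in> M"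
      by (auto simp: central_mod_def)
    have "g \<otimes> inv x \<otimes> inv g \<otimes> inv (inv x) \<in> M" if g: "g \<in> carrier G" for g
    proof -
      have "inv x \<otimes> inv (g \<otimes> x \<otimes> inv g \<otimes> inv x) \<otimes> inv (inv x) \<in> M"
        using cM[OF inv_closed[OF x(1)]] subgroup.m_inv_closed[OF sM x(2)[OF g]] by blast
      moreover have "inv x \<otimes> inv (g \<otimes> x \<otimes> inv g \<otimes> inv x) \<otimes> inv (inv x) = g \<otimes> inv x \<otimes> inv g \<otimes> inv (inv x)"
        using g x(1) by (simp add: inv_mult_group m_assoc[symmetric])
      ultimately show ?thesis by simp
    qed
    then show "inv x \<in> {z. central_mod M z}" using x by (auto simp: central_mod_def)
    fix y assume "y \<in> {z. central_mod M z}"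
    then have y: "y \<in> carrier G" "\<And>g. g \<in> carrier G \<Longrightarrow> g \<otimes> y \<otimes> inv g \<otimes> inv y \<in> M"
      by (auto simp: central_mod_def)
    have "g \<otimes> (x \<otimes> y) \<otimes> inv g \<otimes> inv (x \<otimes> y) \<in> M" if g: "g \<in> carrier G" for g
    proof -
      have "(g \<otimes> x \<otimes> inv g \<otimes> inv x) \<otimes> (x \<otimes> (g \<otimes> y \<otimes> inv g \<otimes> inv y) \<otimes> inv x) \<in> M"
        using cM[OF x(1) y(2)[OF g]] x(2)[OF g] subgroup.m_closed[OF sM] by blast
      moreover have "(g \<otimes> x \<otimes> inv g \<otimes> inv x) \<otimes> (x \<otimes> (g \<otimes> y \<otimes> inv g \<otimes> inv y) \<otimes> inv x)
          = g \<otimes> (x \<otimes> y) \<otimes> inv g \<otimes> inv (x \<otimes> y)"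
        using g x(1) y(1) by (simp add: inv_mult_group m_assoc inv_solve_left)
          (simp add: m_assoc[symmetric])
      ultimately show ?thesis by simp
    qed
    then show "x \<otimes> y \<in> {z. central_mod M z}" using x y by (auto simp: central_mod_def)
  qed
qed

lemma center_subgroup: "subgroup (center G) G"
  using central_mod_subgroup[OF one_is_normal] by (simp add: in_center_iff[symmetric])

lemma coprime_pows_in_subgroup:
  assumes S: "subgroup S G" and x: "x \<in> carrier G" and uv: "coprime u v"
    and "x [^] (u::nat) \<in> S" "x [^] (v::nat) \<in> S"
  shows "x \<in> S"
proof -
  obtain a b where ab: "int u * a + int v * b = 1"
    using uv bezout_int[of "int u" "int v"] by (auto simp: mult.commute)
  have "x = x [^] (int u * a + int v * b)" using x ab by simp
  also have "\<dots> = (x [^] u) [^] a \<otimes> (x [^] v) [^] b"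
    using x by (simp add: int_pow_mult int_pow_pow[symmetric] int_pow_int)
  also have "\<dots> \<in> S" using assms by (intro subgroup.m_closed[OF S] subgroup_int_pow_closed[OF S])
  finally show ?thesis .
qed

text \<open>Split off one prime at a time: if \<open>x\<close> has order dividing \<open>q * r\<close> with \<open>q\<close>, \<open>r\<close> coprime, then \<open>x\<close> is
  a product of powers of \<open>x [^] q\<close> and \<open>x [^] r\<close>, so one of these is still outside \<open>S\<close>.\<close>

lemma prime_power_part_outside:
  assumes S: "subgroup S G" and x: "x \<in> carrier G" "x [^] (n::nat) = \<one>" "n > 0" "x \<notin> S"
  shows "\<exists>j p a. x [^] (j::nat) \<notin> S \<and> prime (p::nat) \<and> (x [^] j) [^] (p ^ a) = \<one>"
  using x
proof (induction n arbitrary: x rule: less_induct)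
  case (less n)
  have "n \<noteq> 1" using less.prems S by (auto simp: subgroup.one_closed)
  then obtain p where p: "prime p" "p dvd n" by (meson prime_factor_nat)
  obtain r where r: "n = p ^ multiplicity p n * r" "\<not> p dvd r"
    using less.prems(3) p(1) multiplicity_decompose'[of n p] by (metis not_prime_unit gr0_conv_Suc nat.simps(3))
  define q where "q = p ^ multiplicity p n"
  have n: "n = q * r" using r q_def by simp
  have cop: "coprime q r" using r p by (simp add: q_def prime_imp_coprime)
  have "q > 1" using p less.prems(3) by (metis q_def one_less_power prime_gt_1_nat prime_multiplicity_gt_zero_iff prime_elem_multiplicity_eq_zero_iff prime_imp_prime_elem gr0I)
  then have rn: "r < n" "r > 0" using n less.prems(3) by auto
  from coprime_pows_in_subgroup[OF S less.prems(1) cop] less.prems(4)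
  consider "x [^] r \<notin> S" | "x [^] q \<notin> S" by blast
  then show ?case
  proof cases
    case 1
    have "(x [^] r) [^] (p ^ multiplicity p n) = \<one>"
      unfolding q_def[symmetric] nat_pow_pow[OF less.prems(1)] mult.commute[of r] n[symmetric]
      by (rule less.prems(2))
    then show ?thesis using 1 p by blast
  next
    case 2
    have "(x [^] q) [^] r = \<one>"
      unfolding nat_pow_pow[OF less.prems(1)] n[symmetric] by (rule less.prems(2))
    then obtain j p a where "(x [^] q) [^] (j::nat) \<notin> S" "prime (p::nat)" "((x [^] q) [^] j) [^] (p ^ a) = \<one>"
      using less.IH[of r "x [^] q"] rn 2 less.prems(1) by auto
    then show ?thesis using less.prems(1) by (metis nat_pow_pow)
  qed
qed

lemma normal_trivial_Int_commute:
  assumes M: "M \<lhd> G" and N: "N \<lhd> G" and MN: "M \<inter> N = {\<one>}" and x: "x \<in> M" and y: "y \<in> N"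
  shows "x \<otimes> y = y \<otimes> x"
proof -
  have sM: "subgroup M G" and sN: "subgroup N G" using M N normal_invE by auto
  have c: "x \<in> carrier G" "y \<in> carrier G" using x y sM sN by (auto dest: subgroup.mem_carrier)
  have "x \<otimes> (y \<otimes> inv x \<otimes> inv y) \<in> M"
    using x normal_invE(2)[OF M c(2) subgroup.m_inv_closed[OF sM x]] subgroup.m_closed[OF sM] by blast
  moreover have "(x \<otimes> y \<otimes> inv x) \<otimes> inv y \<in> N"
    using y normal_invE(2)[OF N c(1) y] subgroup.m_closed[OF sN] subgroup.m_inv_closed[OF sN] by blast
  ultimately have "x \<otimes> y \<otimes> inv x \<otimes> inv y \<in> M \<inter> N" using c by (simp add: m_assoc)
  then show ?thesis using MN commutator_one_iff c by auto
qed

lemma minimal_normal_disjoint: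
  assumes "minimal_normal M" "minimal_normal N" "M \<noteq> N"
  shows "M \<inter> N = {\<one>}"
proof (rule ccontr)
  assume a: "M \<inter> N \<noteq> {\<one>}"
  have "M \<inter> N \<lhd> G" using assms normal_subgroup_intersect by (auto simp: minimal_normal_def)
  then have "M \<inter> N = M" "M \<inter> N = N" using a assms unfolding minimal_normal_def by auto
  then show False using assms(3) by auto
qed

lemma minimal_normal_exists:
  assumes fin: "finite (carrier G)" and N: "N \<lhd> G" "N \<noteq> {\<one>}"
  obtains M where "minimal_normal M" "M \<subseteq> N"
proof -
  define C where "C = {M. M \<lhd> G \<and> M \<subseteq> N \<and> M \<noteq> {\<one>}}"
  have "C \<subseteq> Pow (carrier G)" unfolding C_def using normal_imp_subgroup subgroup.subset by blast
  then have "finite C" using fin finite_subset by auto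
  moreover have "N \<in> C" using N by (simp add: C_def)
  ultimately obtain M where M: "M \<in> C" "\<And>K. K \<in> C \<Longrightarrow> K \<subseteq> M \<Longrightarrow> K = M"
    using finite_has_minimal[of C] by (metis empty_iff)
  then have "minimal_normal M" unfolding minimal_normal_def C_def by blast
  then show ?thesis using M(1) that by (auto simp: C_def)
qed

text \<open>The elements of the center of \<open>M\<close> whose \<open>q\<close>-th power is trivial form a normal subgroup of \<open>G\<close>.  It
  contains all commutators \<open>c\<close> of \<open>z\<close>: such a \<open>c\<close> is the quotient of two conjugates of \<open>z\<close>, both of
  which centralize \<open>M\<close>, and these commute because \<open>z\<close> commutes with \<open>c \<in> M\<close>.  As \<open>z\<close> is not central,
  the subgroup is nontrivial, so by minimality it is \<open>M\<close>.\<close>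

lemma central_mod_self_centralizing:
  assumes M: "minimal_normal M" and z: "central_mod M z" "z \<notin> center G"
    and zq: "z [^] (q::nat) = \<one>" and zM: "\<And>m. m \<in> M \<Longrightarrow> z \<otimes> m = m \<otimes> z"
    and m: "m \<in> M"
  shows "m [^] q = \<one>" and "\<And>x. x \<in> M \<Longrightarrow> m \<otimes> x = x \<otimes> m"
proof -
  have nM: "M \<lhd> G" using M by (simp add: minimal_normal_def)
  have sM: "subgroup M G" and cM: "\<And>x h. x \<in> carrier G \<Longrightarrow> h \<in> M \<Longrightarrow> x \<otimes> h \<otimes> inv x \<in> M"
    using nM normal_invE by auto
  have Mc: "\<And>x. x \<in> M \<Longrightarrow> x \<in> carrier G" using sM by (auto dest: subgroup.mem_carrier)
  have zc: "z \<in> carrier G" using z by (simp add: central_mod_def)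
  \<comment> \<open>The normal subgroup that turns out to be all of \<open>M\<close>.\<close>
  define N where "N = {m \<in> M. (\<forall>x\<in>M. m \<otimes> x = x \<otimes> m) \<and> m [^] q = \<one>}"
  have conj_commute: "(g \<otimes> y \<otimes> inv g) \<otimes> x = x \<otimes> (g \<otimes> y \<otimes> inv g)"
    if g: "g \<in> carrier G" and y: "y \<in> carrier G" "\<And>x. x \<in> M \<Longrightarrow> y \<otimes> x = x \<otimes> y" and x: "x \<in> M" for g y x
  proof -
    have "inv g \<otimes> x \<otimes> g \<in> M" using cM[of "inv g" x] g x by simp
    then have "y \<otimes> (inv g \<otimes> x \<otimes> g) = (inv g \<otimes> x \<otimes> g) \<otimes> y" using y by blast
    then have "g \<otimes> (y \<otimes> (inv g \<otimes> x \<otimes> g)) \<otimes> inv g = g \<otimes> ((inv g \<otimes> x \<otimes> g) \<otimes> y) \<otimes> inv g" by simp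
    then show ?thesis using g y(1) Mc[OF x] by (simp add: m_assoc) (simp add: m_assoc[symmetric])
  qed
  have "subgroup N G"
  proof (rule subgroupI)
    show "N \<subseteq> carrier G" using Mc by (auto simp: N_def)
    have "\<one> \<in> N" using sM Mc by (auto simp: N_def subgroup.one_closed)
    then show "N \<noteq> {}" by blast
  next
    fix a assume a: "a \<in> N"
    have "inv a \<otimes> x = x \<otimes> inv a" if "x \<in> M" for x
      using a that Mc inv_commute by (auto simp: N_def)
    then show "inv a \<in> N"
      using a Mc sM by (auto simp: N_def nat_pow_inv subgroup.m_inv_closed)
    fix b assume b: "b \<in> N"
    have "a \<otimes> b \<otimes> x = x \<otimes> (a \<otimes> b)" if x: "x \<in> M" for x
    proof -
      have "a \<in> carrier G" "b \<in> carrier G" "x \<in> carrier G" "a \<otimes> x = x \<otimes> a" "b \<otimes> x = x \<otimes> b"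
        using a b x Mc by (auto simp: N_def)
      then show ?thesis by (metis m_assoc)
    qed
    moreover have "a \<otimes> b \<in> M" using a b subgroup.m_closed[OF sM] unfolding N_def by blast
    moreover have "(a \<otimes> b) [^] q = \<one>"
    proof -
      have "a \<in> M" "b \<in> M" "a [^] q = \<one>" "b [^] q = \<one>" and "a \<otimes> b = b \<otimes> a"
        using a b unfolding N_def by blast+
      then show ?thesis using Mc by (simp only: pow_mult_distrib) simp
    qed
    ultimately show "a \<otimes> b \<in> N" unfolding N_def by blast
  qed
  then have "N \<lhd> G"
  proof (rule normal_invI)
    fix g y assume g: "g \<in> carrier G" and "y \<in> N"
    then have y: "y \<in> M" "\<And>x. x \<in> M \<Longrightarrow> y \<otimes> x = x \<otimes> y" "y [^] q = \<one>" by (auto simp: N_def)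
    then show "g \<otimes> y \<otimes> inv g \<in> N"
      using conj_commute[OF g Mc[OF y(1)] y(2)] cM[OF g y(1)] conj_nat_pow[OF g Mc[OF y(1)], of q] g
      unfolding N_def by simp
  qed
  moreover have c: "g \<otimes> z \<otimes> inv g \<otimes> inv z \<in> N" if g: "g \<in> carrier G" for g
  proof -
    define y where "y = g \<otimes> z \<otimes> inv g \<otimes> inv z"
    have yM: "y \<in> M" using z g by (simp add: central_mod_def y_def)
    have "y \<otimes> x = x \<otimes> y" if x: "x \<in> M" for x
    proof -
      have 1: "(g \<otimes> z \<otimes> inv g) \<otimes> x = x \<otimes> (g \<otimes> z \<otimes> inv g)" using conj_commute[OF g zc zM x] .
      have 2: "inv z \<otimes> x = x \<otimes> inv z"
        using zM[OF x] zc Mc[OF x] by (rule inv_commute)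
      show ?thesis unfolding y_def using 1 2 g zc Mc[OF x] by (metis inv_closed m_assoc m_closed)
    qed
    moreover have "y [^] q = \<one>"
    proof -
      have yz: "y \<otimes> z = g \<otimes> z \<otimes> inv g" using g zc by (simp add: y_def m_assoc)
      have "(y \<otimes> z) [^] q = y [^] q \<otimes> z [^] q"
        using zM[OF yM] Mc[OF yM] zc by (intro pow_mult_distrib) auto
      then show ?thesis using yz conj_nat_pow[OF g zc, of q] zq g Mc[OF yM] by simp
    qed
    ultimately show ?thesis using yM by (auto simp: N_def y_def)
  qed
  moreover have "N \<noteq> {\<one>}"
    using c z by (auto simp: in_center_iff central_mod_def)
  ultimately have "N = M" using M unfolding minimal_normal_def by (auto simp: N_def)
  then show "m [^] q = \<one>" and "\<And>x. x \<in> M \<Longrightarrow> m \<otimes> x = x \<otimes> m" using m by (auto simp: N_def)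
qed

end

section \<open>A subgroup with a faithful irreducible representation\<close>

locale faithful_irreducible_on_subgroup = group G for G :: "('g, 'm) monoid_scheme" (structure) +
  fixes K :: "'g set" and n :: nat and \<rho> :: "'g \<Rightarrow> 'f::field mat"
  assumes finite_carrier: "finite (carrier G)"
    and subgroup_K: "subgroup K G"
    and irreducible: "irreducible_representation (G\<lparr>carrier := K\<rparr>) n \<rho>"
    and faithful: "inj_on \<rho> K"
    and char_not_dvd: "\<not> CHAR('f) dvd Coset.order G"
begin

lemma K_closed: "x \<in> K \<Longrightarrow> x \<in> carrier G" "\<one> \<in> K" "x \<in> K \<Longrightarrow> y \<in> K \<Longrightarrow> x \<otimes> y \<in> K" "x \<in> K \<Longrightarrow> inv x \<in> K"
  "x \<in> K \<Longrightarrow> x [^] (k::nat) \<in> K"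
  using subgroup_K subgroup_nat_pow_closed
  by (auto simp: subgroup.mem_carrier subgroup.one_closed subgroup.m_closed subgroup.m_inv_closed)

lemma \<rho>_carrier: "x \<in> K \<Longrightarrow> \<rho> x \<in> carrier_mat n n"
    and \<rho>_mult: "x \<in> K \<Longrightarrow> y \<in> K \<Longrightarrow> \<rho> (x \<otimes> y) = \<rho> x * \<rho> y"
    and \<rho>_one: "\<rho> \<one> = 1\<^sub>m n"
    and n_pos: "n > 0"
proof -
  have "group (G\<lparr>carrier := K\<rparr>)" using subgroup_K by (rule subgroup_imp_group)
  from representation_iff[OF this, of n \<rho>] irreducible
  show "x \<in> K \<Longrightarrow> \<rho> x \<in> carrier_mat n n" "x \<in> K \<Longrightarrow> y \<in> K \<Longrightarrow> \<rho> (x \<otimes> y) = \<rho> x * \<rho> y"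
    "\<rho> \<one> = 1\<^sub>m n" "n > 0"
    by (auto simp: irreducible_representation_def)
qed

lemma \<rho>_vec: "x \<in> K \<Longrightarrow> w \<in> carrier_vec n \<Longrightarrow> \<rho> x *\<^sub>v w \<in> carrier_vec n"
  by (rule mult_mat_vec_carrier[OF \<rho>_carrier])

lemma \<rho>_mult_vec: "x \<in> K \<Longrightarrow> y \<in> K \<Longrightarrow> w \<in> carrier_vec n \<Longrightarrow> \<rho> (x \<otimes> y) *\<^sub>v w = \<rho> x *\<^sub>v (\<rho> y *\<^sub>v w)"
  by (simp add: \<rho>_mult assoc_mult_mat_vec[OF \<rho>_carrier \<rho>_carrier])

lemma invariant_subspace:
  assumes "W \<subseteq> carrier_vec n" "0\<^sub>v n \<in> W" "\<And>v w. v \<in> W \<Longrightarrow> w \<in> W \<Longrightarrow> v + w \<in> W"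
    "\<And>c w. w \<in> W \<Longrightarrow> c \<cdot>\<^sub>v w \<in> W" "\<And>k w. k \<in> K \<Longrightarrow> w \<in> W \<Longrightarrow> \<rho> k *\<^sub>v w \<in> W"
  shows "W = {0\<^sub>v n} \<or> W = carrier_vec n"
proof -
  have "VectorSpace.subspace class_ring W (module_vec TYPE('f) n)"
    using assms by (simp add: subspace_vec_iff)
  then show ?thesis using irreducible assms(5) unfolding irreducible_representation_def by simp
qed

lemma trivial_if_fixes_all:
  assumes x: "x \<in> K" and "\<And>w. w \<in> carrier_vec n \<Longrightarrow> \<rho> x *\<^sub>v w = w"
  shows "x = \<one>"
proof -
  have "\<rho> x = \<rho> \<one>"
    using assms \<rho>_carrier[OF x] by (intro eq_mat_by_action[of _ n]) (auto simp: \<rho>_one)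
  then show ?thesis using faithful x K_closed(2) by (auto dest: inj_onD)
qed

text \<open>Schur: the fixed space of a central element is invariant under \<open>K\<close>.\<close>

lemma central_fixes_only_zero:
  assumes z: "z \<in> K" "\<And>k. k \<in> K \<Longrightarrow> z \<otimes> k = k \<otimes> z" "z \<noteq> \<one>"
    and w: "w \<in> carrier_vec n" "\<rho> z *\<^sub>v w = w"
  shows "w = 0\<^sub>v n"
proof -
  define W where "W = {w \<in> carrier_vec n. \<rho> z *\<^sub>v w = w}"
  have "\<rho> z *\<^sub>v 0\<^sub>v n = 0\<^sub>v n" using \<rho>_carrier[OF z(1)] by (auto simp: mult_mat_vec_def scalar_prod_def)
  then have "W = {0\<^sub>v n} \<or> W = carrier_vec n"
  proof (intro invariant_subspace)
    fix k w assume k: "k \<in> K" and "w \<in> W"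
    then have w: "w \<in> carrier_vec n" "\<rho> z *\<^sub>v w = w" by (auto simp: W_def)
    have "\<rho> z *\<^sub>v (\<rho> k *\<^sub>v w) = \<rho> (k \<otimes> z) *\<^sub>v w"
      using \<rho>_mult_vec[OF z(1) k w(1)] z(2)[OF k] by simp
    also have "\<dots> = \<rho> k *\<^sub>v w" using \<rho>_mult_vec[OF k z(1) w(1)] w(2) by simp
    finally show "\<rho> k *\<^sub>v w \<in> W" using w k \<rho>_vec by (simp add: W_def)
  qed (auto simp: W_def mult_add_distrib_mat_vec[OF \<rho>_carrier[OF z(1)]] mult_mat_vec[OF \<rho>_carrier[OF z(1)]])
  moreover have "W \<noteq> carrier_vec n"
    using trivial_if_fixes_all[OF z(1)] z(3) unfolding W_def by blast
  ultimately show ?thesis using w unfolding W_def by blast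
qed

text \<open>A column of the summed matrix is fixed by \<open>\<rho> z\<close>, since multiplication by \<open>z\<close> permutes the summands
  cyclically; hence it is zero.\<close>

lemma central_power_sum:
  assumes z: "z \<in> K" "\<And>k. k \<in> K \<Longrightarrow> z \<otimes> k = k \<otimes> z" "z \<noteq> \<one>" "z [^] (p::nat) = \<one>"
    and y: "y \<in> K" and ij: "i < n" "j < n"
  shows "(\<Sum>t<p. \<rho> (y \<otimes> z [^] t) $$ (i,j)) = 0"
proof -
  define w where "w = vec n (\<lambda>i. \<Sum>t<p. \<rho> (y \<otimes> z [^] t) $$ (i,j))"
  have yz: "y \<otimes> z [^] t \<in> K" for t :: nat by (rule K_closed(3)[OF y K_closed(5)[OF z(1)]])
  have "\<rho> z *\<^sub>v w = w"
  proof (rule eq_vecI)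
    fix i assume "i < dim_vec w"
    then have i: "i < n" by (simp add: w_def)
    have step: "z \<otimes> (y \<otimes> z [^] t) = y \<otimes> z [^] Suc t" for t
    proof -
      have "z \<otimes> (y \<otimes> z [^] t) = (y \<otimes> z [^] t) \<otimes> z" using z(2) yz by blast
      then show ?thesis using y z(1) K_closed(1) by (simp add: m_assoc)
    qed
    have entry: "(\<Sum>l<n. \<rho> z $$ (i,l) * \<rho> (y \<otimes> z [^] t) $$ (l,j)) = (\<rho> z * \<rho> (y \<otimes> z [^] t)) $$ (i,j)"
      for t :: nat
      using i ij(2) \<rho>_carrier[OF z(1)] \<rho>_carrier[OF yz[of t]]
      by (simp add: scalar_prod_def lessThan_atLeast0)
    have "(\<rho> z *\<^sub>v w) $ i = (\<Sum>l<n. \<rho> z $$ (i,l) * (\<Sum>t<p. \<rho> (y \<otimes> z [^] t) $$ (l,j)))"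
      using i \<rho>_carrier[OF z(1)]
      by (auto simp: w_def scalar_prod_def lessThan_atLeast0 intro!: sum.cong)
    also have "\<dots> = (\<Sum>t<p. \<Sum>l<n. \<rho> z $$ (i,l) * \<rho> (y \<otimes> z [^] t) $$ (l,j))"
      by (subst sum.swap) (simp add: sum_distrib_left)
    also have "\<dots> = (\<Sum>t<p. (\<rho> z * \<rho> (y \<otimes> z [^] t)) $$ (i,j))"
      by (simp only: entry)
    also have "\<dots> = (\<Sum>t<p. \<rho> (y \<otimes> z [^] Suc t) $$ (i,j))"
      by (simp only: \<rho>_mult[OF z(1) yz, symmetric] step)
    also have "\<dots> = (\<Sum>t<p. \<rho> (y \<otimes> z [^] t) $$ (i,j))"
      using sum.lessThan_Suc_shift[of "\<lambda>t. \<rho> (y \<otimes> z [^] t) $$ (i,j)" p] z(4)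
      by (simp del: nat_pow_Suc)
    finally show "(\<rho> z *\<^sub>v w) $ i = w $ i" using i by (simp add: w_def)
  qed (use \<rho>_carrier[OF z(1)] in \<open>auto simp: w_def\<close>)
  then have "w = 0\<^sub>v n"
    using central_fixes_only_zero[OF z(1,2,3), of w] by (simp add: w_def)
  then have "w $ i = 0" using ij by simp
  then show ?thesis using ij by (simp add: w_def)
qed

text \<open>If \<open>u\<close> is not a power of \<open>w\<close>, then no \<open>u \<otimes> w [^] i\<close> is trivial, so the powers of each of these elements
  have images under \<open>\<rho>\<close> that sum to zero.  In the sum over all \<open>i < p\<close>, exchange the order of summation:
  the terms \<open>u [^] j \<otimes> w [^] (i * j)\<close> with fixed \<open>j > 0\<close> also sum to zero, and those with \<open>j = 0\<close> give
  \<open>p\<close> times the identity.  So \<open>p\<close> vanishes in the field although it divides the group order.\<close>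

lemma central_order_p_unique:
  assumes p: "prime (p::nat)"
    and w: "w \<in> K" "\<And>k. k \<in> K \<Longrightarrow> w \<otimes> k = k \<otimes> w" "w [^] p = \<one>" "w \<noteq> \<one>"
    and u: "u \<in> K" "\<And>k. k \<in> K \<Longrightarrow> u \<otimes> k = k \<otimes> u" "u [^] p = \<one>"
  shows "\<exists>k::nat. u = w [^] k"
proof (rule ccontr)
  assume notin: "\<not> (\<exists>k::nat. u = w [^] k)"
  have uw: "u \<in> carrier G" "w \<in> carrier G" using u w K_closed by auto
  have pow_central: "y [^] i \<otimes> k = k \<otimes> y [^] i"
    if "y \<in> K" "\<And>k. k \<in> K \<Longrightarrow> y \<otimes> k = k \<otimes> y" "k \<in> K" for y k and i :: nat
    using that K_closed(1) by (intro group_commutes_pow) auto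
  have ne: "u \<otimes> w [^] i \<noteq> \<one>" if "i < p" for i
  proof
    assume "u \<otimes> w [^] i = \<one>"
    moreover have "w [^] i \<otimes> w [^] (p - i) = \<one>" using that w(3) uw by (simp add: nat_pow_mult)
    ultimately have "u = w [^] (p - i)"
      using uw by (metis inv_equality inv_comm nat_pow_closed)
    then show False using notin by blast
  qed
  let ?F = "\<lambda>x. \<rho> x $$ (0,0)"
  have z1: "(\<Sum>j<p. ?F ((u \<otimes> w [^] i) [^] j)) = 0" if i: "i < p" for i
  proof -
    have c: "(u \<otimes> w [^] i) \<otimes> k = k \<otimes> (u \<otimes> w [^] i)" if k: "k \<in> K" for k
      using u(2)[OF k] pow_central[OF w(1,2) k, of i] uw K_closed(1)[OF k]
      by (metis m_assoc nat_pow_closed)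
    have "(u \<otimes> w [^] i) [^] p = u [^] p \<otimes> (w [^] i) [^] p"
      using uw u(2)[of "w [^] i"] w(1) K_closed by (intro pow_mult_distrib) auto
    also have "(w [^] i) [^] p = (w [^] p) [^] i" using uw by (simp add: nat_pow_pow mult.commute)
    finally have "(u \<otimes> w [^] i) [^] p = \<one>" using u(3) w(3) by simp
    then have "(\<Sum>t<p. ?F (\<one> \<otimes> (u \<otimes> w [^] i) [^] t)) = 0"
      using c ne[OF i] u(1) w(1) K_closed n_pos by (intro central_power_sum) auto
    then show ?thesis using uw by simp
  qed
  have z2: "(\<Sum>i<p. ?F (u [^] j \<otimes> (w [^] j) [^] i)) = (if j = 0 then of_nat p else 0)" if j: "j < p" for j
  proof (cases "j = 0")
    case True
    then show ?thesis using \<rho>_one n_pos uw by simp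
  next
    case False
    have cop: "coprime j p" 
      using j False prime_imp_coprime[OF p, of j]
      by (metis coprime_commute nat_dvd_not_less neq0_conv)
    have "w [^] j \<noteq> \<one>"
    proof
      assume "w [^] j = \<one>"
      then have "w \<in> {\<one>}" using coprime_pows_in_subgroup[OF triv_subgroup uw(2) cop] w(3) by simp
      then show False using w(4) by simp
    qed
    moreover have "(w [^] j) [^] p = \<one>"
    proof -
      have "(w [^] j) [^] p = (w [^] p) [^] j" using uw by (simp add: nat_pow_pow mult.commute)
      then show ?thesis using w(3) by simp
    qed
    ultimately have "(\<Sum>i<p. ?F (u [^] j \<otimes> (w [^] j) [^] i)) = 0"
      using u(1) w(1) K_closed n_pos pow_central[OF w(1,2)] by (intro central_power_sum) auto
    then show ?thesis using False by simp
  qed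
  have "0 = (\<Sum>i<p. \<Sum>j<p. ?F ((u \<otimes> w [^] i) [^] j))" using z1 by simp
  also have "\<dots> = (\<Sum>i<p. \<Sum>j<p. ?F (u [^] j \<otimes> (w [^] j) [^] i))"
  proof (intro sum.cong refl)
    fix i j :: nat
    have "(u \<otimes> w [^] i) [^] j = u [^] j \<otimes> (w [^] i) [^] j"
      using uw u(2)[of "w [^] i"] w(1) K_closed by (intro pow_mult_distrib) auto
    moreover have "(w [^] i) [^] j = (w [^] j) [^] i" using uw by (simp add: nat_pow_pow mult.commute)
    ultimately show "?F ((u \<otimes> w [^] i) [^] j) = ?F (u [^] j \<otimes> (w [^] j) [^] i)" by simp
  qed
  also have "\<dots> = (\<Sum>j<p. if j = 0 then of_nat p else 0)"
    by (subst sum.swap) (auto intro!: sum.cong simp: z2)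
  also have "\<dots> = of_nat p" using prime_gt_0_nat[OF p] by simp
  finally have "CHAR('f) dvd p" by (metis of_nat_eq_0_iff_char_dvd)
  moreover have "CHAR('f) \<noteq> 1" by simp
  ultimately have "CHAR('f) = p" using p unfolding prime_nat_iff by blast
  moreover have "ord w dvd p" "ord w \<noteq> 1"
    using w(3,4) uw(2) pow_eq_id[of w p] pow_eq_id[of w 1] by auto
  then have "ord w = p" using p unfolding prime_nat_iff by blast
  moreover have "ord w dvd Coset.order G" using uw(2) by (rule ord_dvd_group_order)
  ultimately show False using char_not_dvd by simp
qed

text \<open>Unique subgroups of order \<open>p\<close> make the \<open>p\<close>-part of the center cyclic: some power \<open>v\<close> of \<open>z\<close> has
  the same \<open>p ^ (b - 1)\<close>-th power as \<open>x\<close>, and the induction hypothesis applies to \<open>x \<otimes> inv v\<close>.\<close>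

lemma central_p_elements_nested:
  assumes p: "prime (p::nat)"
    and z: "z \<in> K" "\<And>k. k \<in> K \<Longrightarrow> z \<otimes> k = k \<otimes> z" "z [^] (p ^ Suc a) = \<one>" "z [^] (p ^ a) \<noteq> \<one>"
  shows "b \<le> Suc a \<Longrightarrow> x \<in> K \<Longrightarrow> (\<And>k. k \<in> K \<Longrightarrow> x \<otimes> k = k \<otimes> x) \<Longrightarrow> x [^] (p ^ b) = \<one> \<Longrightarrow> \<exists>k::nat. x = z [^] k"
proof (induction b arbitrary: x)
  case 0
  then have "x = z [^] (0::nat)" using K_closed(1) by simp
  then show ?case by blast
next
  case (Suc b)
  have c: "x \<in> carrier G" "z \<in> carrier G" using Suc.prems z K_closed by auto
  have pow_central: "y [^] i \<otimes> k = k \<otimes> y [^] i"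
    if "y \<in> K" "\<And>k. k \<in> K \<Longrightarrow> y \<otimes> k = k \<otimes> y" "k \<in> K" for y k and i :: nat
    using that K_closed(1) by (intro group_commutes_pow) auto
  have "(z [^] (p ^ a)) [^] p = \<one>" using z(3) c by (simp add: nat_pow_pow mult.commute)
  moreover have "(x [^] (p ^ b)) [^] p = \<one>" using Suc.prems(4) c by (simp add: nat_pow_pow mult.commute)
  ultimately obtain k :: nat where k: "x [^] (p ^ b) = (z [^] (p ^ a)) [^] k"
    using central_order_p_unique[OF p, of "z [^] (p ^ a)" "x [^] (p ^ b)"] z(4)
      pow_central[OF z(1,2)] pow_central[OF Suc.prems(2,3)] K_closed(5)[OF z(1)] K_closed(5)[OF Suc.prems(2)]
    by blast
  define v where "v = z [^] (p ^ (a - b) * k)"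
  have v: "v \<in> K" "\<And>k. k \<in> K \<Longrightarrow> v \<otimes> k = k \<otimes> v"
    using z(1) K_closed pow_central[OF z(1,2)] by (auto simp: v_def)
  have vc: "v \<in> carrier G" using v K_closed by blast
  have exps: "p ^ (a - b) * k * p ^ b = p ^ a * k"
    using Suc.prems(1) by (metis Suc_le_mono le_add_diff_inverse2 mult.assoc mult.commute power_add)
  have vp: "v [^] (p ^ b) = x [^] (p ^ b)"
    unfolding k v_def using c by (simp add: nat_pow_pow exps)
  have iv: "inv v \<otimes> k = k \<otimes> inv v" if "k \<in> K" for k
    using v(2)[OF that] vc K_closed(1)[OF that] by (rule inv_commute)
  have "(x \<otimes> inv v) [^] (p ^ b) = x [^] (p ^ b) \<otimes> inv v [^] (p ^ b)"
    using c vc iv[OF Suc.prems(2)] by (intro pow_mult_distrib) auto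
  then have "(x \<otimes> inv v) [^] (p ^ b) = \<one>"
    using vp c vc by (simp add: nat_pow_inv)
  moreover have "(x \<otimes> inv v) \<otimes> k = k \<otimes> (x \<otimes> inv v)" if k: "k \<in> K" for k
    using Suc.prems(3)[OF k] iv[OF k] c vc K_closed(1)[OF k] by (metis inv_closed m_assoc)
  ultimately obtain l :: nat where l: "x \<otimes> inv v = z [^] l"
    using Suc.IH[of "x \<otimes> inv v"] Suc.prems(1,2) v(1) K_closed by auto
  have "x = (x \<otimes> inv v) \<otimes> v" using c vc by (simp add: m_assoc)
  then have "x = z [^] (l + p ^ (a - b) * k)"
    using l c by (simp add: v_def nat_pow_mult)
  then show ?case by blast
qed

lemma central_p_elements_comparable:
  assumes p: "prime (p::nat)"
    and z: "z \<in> K" "\<And>k. k \<in> K \<Longrightarrow> z \<otimes> k = k \<otimes> z" "z [^] (p ^ a) = \<one>"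
    and x: "x \<in> K" "\<And>k. k \<in> K \<Longrightarrow> x \<otimes> k = k \<otimes> x" "x [^] (p ^ b) = \<one>"
  shows "(\<exists>k::nat. x = z [^] k) \<or> (\<exists>k::nat. z = x [^] k)"
proof -
  define A where "A y = (LEAST a. y [^] (p ^ a) = \<one>)" for y
  have A: "y [^] (p ^ A y) = \<one>" "\<And>c. c < A y \<Longrightarrow> y [^] (p ^ c) \<noteq> \<one>"
    if "y [^] (p ^ a) = \<one>" for y a
    unfolding A_def using LeastI[of "\<lambda>a. y [^] (p ^ a) = \<one>", OF that] not_less_Least by blast+
  \<comment> \<open>The element of larger order generates the other one.\<close>
  have main: "\<exists>k::nat. x = z [^] k"
    if z: "z \<in> K" "\<And>k. k \<in> K \<Longrightarrow> z \<otimes> k = k \<otimes> z" "z [^] (p ^ a) = \<one>"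
    and x: "x \<in> K" "\<And>k. k \<in> K \<Longrightarrow> x \<otimes> k = k \<otimes> x" "x [^] (p ^ b) = \<one>" and le: "A x \<le> A z" for x z a b
  proof (cases "A z")
    case 0
    then have "x = z [^] (0::nat)" using A(1)[OF x(3)] le K_closed(1)[OF x(1)] by simp
    then show ?thesis by blast
  next
    case (Suc c)
    then show ?thesis
      using central_p_elements_nested[OF p z(1,2), of c "A x" x] A(1)[OF z(3)] A(2)[OF z(3), of c]
        A(1)[OF x(3)] x le by auto
  qed
  show ?thesis
  proof (cases "A x \<le> A z")
    case True
    then have "\<exists>k::nat. x = z [^] k" by (intro main[of z a x b] z x)
    then show ?thesis by blast
  next
    case False
    then have "\<exists>k::nat. z = x [^] k" by (intro main[of x b z a] z x) auto
    then show ?thesis by blast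
  qed
qed

definition obstructions :: "'g set set" where
  "obstructions = {M. minimal_normal M \<and> M \<inter> K = {\<one>}}"

definition witness :: "'g set \<Rightarrow> 'g \<Rightarrow> nat \<Rightarrow> nat \<Rightarrow> bool" where
  "witness M z p a \<longleftrightarrow> z \<in> K \<and> z \<notin> center G \<and> central_mod M z \<and> prime p \<and> z [^] (p ^ a) = \<one>"

lemma obstructionD:
  assumes "M \<in> obstructions"
  shows "minimal_normal M" "M \<lhd> G" "subgroup M G" "M \<inter> K = {\<one>}" "M \<noteq> {\<one>}" "M \<subseteq> carrier G"
  using assms unfolding obstructions_def minimal_normal_def
  by (auto dest: normal_imp_subgroup subgroup.mem_carrier)

text \<open>Commutators of \<open>z\<close> with elements of \<open>K\<close> lie in \<open>M \<inter> K\<close>.\<close>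

lemma witness_central_in_K:
  assumes "M \<in> obstructions" "witness M z p a" "k \<in> K"
  shows "z \<otimes> k = k \<otimes> z"
proof -
  have z: "z \<in> K" "central_mod M z" using assms by (auto simp: witness_def)
  have "k \<otimes> z \<otimes> inv k \<otimes> inv z \<in> M \<inter> K"
    using z assms(3) K_closed by (auto simp: central_mod_def)
  then show ?thesis using obstructionD(4)[OF assms(1)] commutator_one_iff[of k z] z(1) assms(3) K_closed(1) by auto
qed

text \<open>Commutators of \<open>z\<close> with elements of \<open>N\<close> lie in \<open>M \<inter> N\<close>, which is trivial.\<close>

lemma witness_commutes_other:
  assumes M: "M \<in> obstructions" "witness M z p a" and N: "N \<in> obstructions" "N \<noteq> M" and x: "x \<in> N"
  shows "z \<otimes> x = x \<otimes> z"
proof -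
  have z: "z \<in> carrier G" "central_mod M z" using M K_closed by (auto simp: witness_def)
  have xc: "x \<in> carrier G" using x obstructionD(6)[OF N(1)] by blast
  have "x \<otimes> z \<otimes> inv x \<otimes> inv z \<in> M" using z xc by (auto simp: central_mod_def)
  moreover have "x \<otimes> (z \<otimes> inv x \<otimes> inv z) \<in> N"
    using x normal_invE(2)[OF obstructionD(2)[OF N(1)] z(1)] obstructionD(3)[OF N(1)]
    by (auto intro: subgroup.m_closed subgroup.m_inv_closed)
  then have "x \<otimes> z \<otimes> inv x \<otimes> inv z \<in> N" using z xc by (simp add: m_assoc)
  ultimately have "x \<otimes> z \<otimes> inv x \<otimes> inv z = \<one>"
    using minimal_normal_disjoint[OF obstructionD(1)[OF M(1)] obstructionD(1)[OF N(1)]] N(2) by auto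
  then show ?thesis using commutator_one_iff z xc by auto
qed

text \<open>If the primes agree, one witness is a power of the other, hence central modulo both \<open>M\<close> and \<open>N\<close>, hence
  central in \<open>G\<close>, as \<open>M \<inter> N\<close> is trivial.\<close>

lemma witness_primes_distinct:
  assumes M: "M \<in> obstructions" "witness M z p a" and N: "N \<in> obstructions" "witness N x q b" and MN: "M \<noteq> N"
  shows "p \<noteq> q"
proof
  assume pq: "p = q"
  have no: False
    if M: "M \<in> obstructions" "witness M z p a" and N: "N \<in> obstructions" "witness N x q b" and MN: "M \<noteq> N"
    and k: "x = z [^] (k::nat)" for M N x z p q a b k
  proof -
    have "central_mod M x"
      using subgroup_nat_pow_closed[OF central_mod_subgroup[OF obstructionD(2)[OF M(1)]], of z k] M(2) k
      by (auto simp: witness_def)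
    moreover have "central_mod N x" "x \<notin> center G" using N(2) by (auto simp: witness_def)
    moreover have "M \<inter> N = {\<one>}"
      using minimal_normal_disjoint[OF obstructionD(1)[OF M(1)] obstructionD(1)[OF N(1)] MN] .
    ultimately show False unfolding in_center_iff central_mod_def by blast
  qed
  have "(\<exists>k::nat. x = z [^] k) \<or> (\<exists>k::nat. z = x [^] k)"
    using M(2) N(2) pq witness_central_in_K[OF M] witness_central_in_K[OF N]
    by (intro central_p_elements_comparable[of p z a x b]) (auto simp: witness_def)
  then show False using no[OF M N MN] no[OF N M MN[symmetric]] by blast
qed

text \<open>An obstruction that can be placed last in the order.  If some \<open>M \<in> S\<close> does not commute with its witness,
  it qualifies, because everything else commutes with that witness.  Otherwise the members of \<open>S\<close> are
  abelian with pairwise coprime exponents and any of them qualifies: if \<open>E\<close> is the product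
  of the other exponents, an element \<open>m = q \<otimes> k\<close> of \<open>M\<close>, with \<open>q\<close> from the others and \<open>k \<in> K\<close>, satisfies
  \<open>m [^] E = k [^] E \<in> M \<inter> K = 1\<close>, which forces \<open>m = 1\<close>.\<close>

lemma independent_obstruction:
  assumes wit: "\<And>M. M \<in> obstructions \<Longrightarrow> \<exists>z p a. witness M z p a"
    and S: "S \<subseteq> obstructions" "S \<noteq> {}" "finite S"
  obtains M where "M \<in> S" "\<not> M \<subseteq> generate G (K \<union> \<Union>(S - {M}))"
proof -
  obtain z p a where w: "\<And>M. M \<in> obstructions \<Longrightarrow> witness M (z M) (p M) (a M)"
    using wit by metis
  have zc: "z M \<in> carrier G" if "M \<in> obstructions" for M
    using w[OF that] K_closed by (auto simp: witness_def)
  show ?thesis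
  proof (cases "\<exists>M\<in>S. \<exists>m\<in>M. z M \<otimes> m \<noteq> m \<otimes> z M")
    case True
    then obtain M m where M: "M \<in> S" "m \<in> M" "z M \<otimes> m \<noteq> m \<otimes> z M" by blast
    then have MO: "M \<in> obstructions" using S by auto
    let ?C = "{x \<in> carrier G. \<forall>s\<in>{z M}. x \<otimes> s = s \<otimes> x}"
    have "K \<union> \<Union>(S - {M}) \<subseteq> ?C"
      using witness_central_in_K[OF MO w[OF MO]] witness_commutes_other[OF MO w[OF MO]] S(1)
        obstructionD(6) K_closed(1) by fastforce
    then have "generate G (K \<union> \<Union>(S - {M})) \<subseteq> ?C"
      using zc[OF MO] by (intro generate_subgroup_incl centralizer_subgroup) auto
    then show ?thesis using that M by fastforce
  next
    case False
    then have zM: "z M \<otimes> m = m \<otimes> z M" if "M \<in> S" "m \<in> M" for M m using that by blast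
    obtain M where M: "M \<in> S" using S(2) by blast
    then have MO: "M \<in> obstructions" using S by auto
    define e where "e M = p M ^ a M" for M
    have exp: "m [^] e N = \<one>" and comm: "\<And>x. x \<in> N \<Longrightarrow> m \<otimes> x = x \<otimes> m" if "N \<in> S" "m \<in> N" for N m
      using central_mod_self_centralizing[OF obstructionD(1), of N "z N" "e N" m] w[of N] S(1) zM[OF that(1)] that
      by (auto simp: witness_def e_def)
    \<comment> \<open>The abelian normal subgroup in which the members of \<open>S\<close> are multiplied.\<close>
    define A where "A = generate G (\<Union>S)"
    have SG: "\<Union>S \<subseteq> carrier G" using S(1) obstructionD(6) by blast
    have Ac: "A \<subseteq> carrier G" unfolding A_def using generate_incl[OF SG] .
    have sA: "subgroup A G" unfolding A_def using generate_is_subgroup[OF SG] .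
    have abelian: "x \<otimes> y = y \<otimes> x" if "x \<in> A" "y \<in> A" for x y
    proof (rule generate_commute[OF SG _ that[unfolded A_def]])
      fix s t assume "s \<in> \<Union>S" "t \<in> \<Union>S"
      then obtain N N' where N: "N \<in> S" "s \<in> N" "N' \<in> S" "t \<in> N'" by blast
      show "s \<otimes> t = t \<otimes> s"
      proof (cases "N = N'")
        case True
        then show ?thesis using comm N by blast
      next
        case False
        have o: "N \<in> obstructions" "N' \<in> obstructions" using N S(1) by auto
        show ?thesis
          using normal_trivial_Int_commute[OF obstructionD(2)[OF o(1)] obstructionD(2)[OF o(2)]
              minimal_normal_disjoint[OF obstructionD(1)[OF o(1)] obstructionD(1)[OF o(2)] False] N(2,4)] .
      qed
    qed
    have nA: "A \<lhd> G"
      unfolding A_def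
      by (rule normal_generateI[OF SG]) (use S(1) normal_invE(2)[OF obstructionD(2)] in blast)
    define E where "E = (\<Prod>N\<in>S - {M}. e N)"
    have cop: "coprime (e M) E"
      unfolding E_def e_def
    proof (rule prod_coprime_right)
      fix N assume N: "N \<in> S - {M}"
      then have NO: "N \<in> obstructions" using S(1) by auto
      have "p M \<noteq> p N" using witness_primes_distinct[OF MO w[OF MO] NO w[OF NO]] N by auto
      moreover have "prime (p M)" "prime (p N)" using w[OF MO] w[OF NO] by (auto simp: witness_def)
      ultimately show "coprime (p M ^ a M) (p N ^ a N)" by (simp add: primes_coprime)
    qed
    \<comment> \<open>The members of \<open>S\<close> other than \<open>M\<close> lie in the part of \<open>A\<close> that is killed by \<open>E\<close>.\<close>
    define Q where "Q = {x \<in> A. x [^] E = \<one>}"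
    have sQ: "subgroup Q G"
    proof (rule subgroupI)
      have "\<one> \<in> Q" using sA by (simp add: Q_def subgroup.one_closed)
      then show "Q \<noteq> {}" by blast
      show "Q \<subseteq> carrier G" using Ac by (auto simp: Q_def)
      fix x y assume x: "x \<in> Q"
      then have xc: "x \<in> A" "x \<in> carrier G" "x [^] E = \<one>" using Ac by (auto simp: Q_def)
      then show "inv x \<in> Q" using sA by (simp add: Q_def nat_pow_inv subgroup.m_inv_closed)
      assume "y \<in> Q"
      then have yc: "y \<in> A" "y \<in> carrier G" "y [^] E = \<one>" using Ac by (auto simp: Q_def)
      have "(x \<otimes> y) [^] E = \<one>"
        using pow_mult_distrib[OF abelian[OF xc(1) yc(1)] xc(2) yc(2), of E] xc yc by simp
      then show "x \<otimes> y \<in> Q" using xc yc sA by (simp add: Q_def subgroup.m_closed)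
    qed
    have nQ: "Q \<lhd> G"
    proof (rule normal_invI[OF sQ])
      fix g y assume g: "g \<in> carrier G" and y: "y \<in> Q"
      then have "y \<in> A" "y \<in> carrier G" "y [^] E = \<one>" using Ac by (auto simp: Q_def)
      then show "g \<otimes> y \<otimes> inv g \<in> Q"
        using g normal_invE(2)[OF nA g] by (simp add: Q_def conj_nat_pow)
    qed
    have "\<Union>(S - {M}) \<subseteq> Q"
    proof
      fix x assume "x \<in> \<Union>(S - {M})"
      then obtain N where N: "N \<in> S - {M}" "x \<in> N" by blast
      have xA: "x \<in> A" using N unfolding A_def by (auto intro: generate.incl)
      have "e N dvd E" unfolding E_def using N S(3) by (intro dvd_prodI) auto
      then obtain l where "E = e N * l" by (auto simp: dvd_def)
      then have "x [^] E = (x [^] e N) [^] l" using xA Ac by (auto simp: nat_pow_pow)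
      then show "x \<in> Q" using xA exp[of N x] N by (simp add: Q_def)
    qed
    moreover have "Q \<subseteq> Q <#> K" "K \<subseteq> Q <#> K"
    proof -
      show "Q \<subseteq> Q <#> K"
      proof
        fix x assume x: "x \<in> Q"
        then have "x = x \<otimes> \<one>" using Ac by (auto simp: Q_def)
        then show "x \<in> Q <#> K" using x K_closed(2) unfolding set_mult_def by blast
      qed
      show "K \<subseteq> Q <#> K"
      proof
        fix x assume x: "x \<in> K"
        then have "x = \<one> \<otimes> x" using K_closed(1) by auto
        then show "x \<in> Q <#> K" using x subgroup.one_closed[OF sQ] unfolding set_mult_def by blast
      qed
    qed
    ultimately have gen: "generate G (K \<union> \<Union>(S - {M})) \<subseteq> Q <#> K"
      by (intro generate_subgroup_incl mult_norm_subgroup[OF nQ subgroup_K]) auto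
    have "m = \<one>" if m: "m \<in> M" "m \<in> Q <#> K" for m
    proof -
      obtain q k where qk: "q \<in> Q" "k \<in> K" "m = q \<otimes> k" using m(2) unfolding set_mult_def by blast
      have mA: "m \<in> A" using m(1) M unfolding A_def by (auto intro: generate.incl)
      have qA: "q \<in> A" "q [^] E = \<one>" using qk by (auto simp: Q_def)
      have c: "m \<in> carrier G" "q \<in> carrier G" "k \<in> carrier G" using mA qA Ac qk(2) K_closed(1) by auto
      have k: "k = inv q \<otimes> m" using qk(3) c by (simp add: cancel_inv_left)
      have "k [^] E = inv q [^] E \<otimes> m [^] E"
        unfolding k using c mA qA abelian subgroup.m_inv_closed[OF sA] by (intro pow_mult_distrib) auto
      then have "m [^] E = k [^] E" using qA c by (simp add: nat_pow_inv)
      moreover have "m [^] E \<in> M" using m(1) obstructionD(3)[OF MO] by (intro subgroup_nat_pow_closed)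
      moreover have "k [^] E \<in> K" using qk(2) by (rule K_closed(5))
      ultimately have "m [^] E \<in> {\<one>}" using obstructionD(4)[OF MO] by auto
      moreover have "m [^] e M \<in> {\<one>}" using exp[OF M m(1)] by simp
      ultimately show "m = \<one>" using coprime_pows_in_subgroup[OF triv_subgroup c(1) cop] by simp
    qed
    moreover have "\<one> \<in> M" using obstructionD(3)[OF MO] by (rule subgroup.one_closed)
    ultimately have "\<not> M \<subseteq> Q <#> K" using obstructionD(5)[OF MO] by blast
    then show ?thesis using that[OF M] gen by blast
  qed
qed

end

section \<open>The induced representation\<close>

text \<open>Vectors of the induced representation are functions on the group with values in coordinate space
  \<open>F\<^sup>n\<close>; values are padded by zero outside the carrier and in the coordinates from \<open>n\<close> on, so
  that each vector is represented by one function only.\<close>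

definition pointwise_scale :: "'f::field \<Rightarrow> ('g \<Rightarrow> nat \<Rightarrow> 'f) \<Rightarrow> 'g \<Rightarrow> nat \<Rightarrow> 'f" where
  "pointwise_scale c f = (\<lambda>x i. c * f x i)"

interpretation pointwise: vector_space "pointwise_scale :: 'f::field \<Rightarrow> ('g \<Rightarrow> nat \<Rightarrow> 'f) \<Rightarrow> _"
  by unfold_locales (auto simp: pointwise_scale_def fun_eq_iff algebra_simps)

lemma sum_fun_apply: "(\<Sum>a\<in>A. F a) x = (\<Sum>a\<in>A. F a x :: 'b::comm_monoid_add)"
  by (induction A rule: infinite_finite_induct) auto

lemma finitely_supported_span:
  assumes "finite A"
  obtains S :: "('g \<Rightarrow> nat \<Rightarrow> 'f::field) set"
  where "finite S" "\<And>f. (\<And>x i. x \<notin> A \<or> i \<ge> n \<Longrightarrow> f x i = 0) \<Longrightarrow> f \<in> pointwise.span S"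
proof -
  define \<delta> :: "'g \<times> nat \<Rightarrow> 'g \<Rightarrow> nat \<Rightarrow> 'f" where "\<delta> p = (\<lambda>x i. if p = (x, i) then 1 else 0)" for p
  have fin: "finite (A \<times> {..<n})" using assms by simp
  have "f \<in> pointwise.span (\<delta> ` (A \<times> {..<n}))" if f: "\<And>x i. x \<notin> A \<or> i \<ge> n \<Longrightarrow> f x i = 0" for f
  proof -
    have "f x i = (\<Sum>p\<in>A \<times> {..<n}. pointwise_scale (f (fst p) (snd p)) (\<delta> p)) x i" for x i
    proof -
      have "(\<Sum>p\<in>A \<times> {..<n}. pointwise_scale (f (fst p) (snd p)) (\<delta> p)) x i =
          (\<Sum>p\<in>A \<times> {..<n}. if p = (x, i) then f x i else 0)"
        by (auto simp: sum_fun_apply pointwise_scale_def \<delta>_def intro!: sum.cong)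
      also have "\<dots> = f x i" using fin f[of x i] by (auto simp: sum.delta)
      finally show ?thesis by simp
    qed
    then have "f = (\<Sum>p\<in>A \<times> {..<n}. pointwise_scale (f (fst p) (snd p)) (\<delta> p))" by (intro ext)
    also have "\<dots> \<in> pointwise.span (\<delta> ` (A \<times> {..<n}))"
      by (intro pointwise.span_sum pointwise.span_scale pointwise.span_base) auto
    finally show ?thesis .
  qed
  then show ?thesis using that fin by blast
qed

lemma (in group) normal_sum_conj:
  assumes M: "M \<lhd> G" and x: "x \<in> carrier G" and g: "g \<in> carrier G"
  shows "(\<Sum>m\<in>M. F (x \<otimes> m \<otimes> g)) = (\<Sum>m\<in>M. F (x \<otimes> g \<otimes> m))"
proof -
  have Mc: "M \<subseteq> carrier G" using M normal_imp_subgroup subgroup.subset by blast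
  have c: "\<And>x h. x \<in> carrier G \<Longrightarrow> h \<in> M \<Longrightarrow> x \<otimes> h \<otimes> inv x \<in> M" using normal_invE(2)[OF M] .
  show ?thesis
  proof (rule sum.reindex_bij_witness[of M "\<lambda>m. g \<otimes> m \<otimes> inv g" "\<lambda>m. inv g \<otimes> m \<otimes> g"])
    fix m assume m: "m \<in> M"
    then have mc: "m \<in> carrier G" using Mc by blast
    show "g \<otimes> (inv g \<otimes> m \<otimes> g) \<otimes> inv g = m" "inv g \<otimes> (g \<otimes> m \<otimes> inv g) \<otimes> g = m"
      using g mc by (simp_all add: m_assoc cancel_inv_left) (simp_all add: m_assoc[symmetric])
    show "inv g \<otimes> m \<otimes> g \<in> M" "g \<otimes> m \<otimes> inv g \<in> M" using c[of "inv g" m] c[of g m] g m by auto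
    show "F (x \<otimes> g \<otimes> (inv g \<otimes> m \<otimes> g)) = F (x \<otimes> m \<otimes> g)"
      using x g mc by (simp add: m_assoc) (simp add: m_assoc[symmetric])
  qed
qed

lemma (in group) subgroup_sum_shift:
  assumes M: "subgroup M G" and x: "x \<in> carrier G" and g: "g \<in> M"
  shows "(\<Sum>m\<in>M. F (x \<otimes> g \<otimes> m)) = (\<Sum>m\<in>M. F (x \<otimes> m))"
proof (rule sum.reindex_bij_witness[of M "\<lambda>m. inv g \<otimes> m" "\<lambda>m. g \<otimes> m"])
  fix m assume m: "m \<in> M"
  have c: "m \<in> carrier G" "g \<in> carrier G" using m g subgroup.mem_carrier[OF M] by auto
  show "g \<otimes> (inv g \<otimes> m) = m" "inv g \<otimes> (g \<otimes> m) = m" "F (x \<otimes> (g \<otimes> m)) = F (x \<otimes> g \<otimes> m)"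
    using c x by (simp_all add: m_assoc[symmetric])
  show "g \<otimes> m \<in> M" "inv g \<otimes> m \<in> M" using m g M by (auto intro: subgroup.m_closed subgroup.m_inv_closed)
qed

context faithful_irreducible_on_subgroup
begin

text \<open>The representation of \<open>G\<close> induced from \<open>\<rho>\<close>; the group acts on it by right translation.\<close>

definition induced :: "('g \<Rightarrow> nat \<Rightarrow> 'f) set" where
  "induced = {f. (\<forall>x i. x \<notin> carrier G \<or> i \<ge> n \<longrightarrow> f x i = 0) \<and>
     (\<forall>k\<in>K. \<forall>x\<in>carrier G. vec n (f (k \<otimes> x)) = \<rho> k *\<^sub>v vec n (f x))}"

definition translate :: "'g \<Rightarrow> ('g \<Rightarrow> nat \<Rightarrow> 'f) \<Rightarrow> 'g \<Rightarrow> nat \<Rightarrow> 'f" where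
  "translate g f = (\<lambda>x. if x \<in> carrier G then f (x \<otimes> g) else 0)"

text \<open>For normal \<open>M\<close>, the complement of the \<open>M\<close>-fixed vectors: the only function fixed by \<open>M\<close> with this
  property is zero, because \<open>card M\<close> is invertible in the field.\<close>

definition averages_to_zero :: "'g set \<Rightarrow> ('g \<Rightarrow> nat \<Rightarrow> 'f) \<Rightarrow> bool" where
  "averages_to_zero M f \<longleftrightarrow> (\<forall>x\<in>carrier G. \<forall>i. (\<Sum>m\<in>M. f (x \<otimes> m) i) = 0)"

lemma translate_simps:
  shows translate_add: "translate g (f + h) = translate g f + translate g h"
    and translate_scale: "translate g (pointwise_scale c f) = pointwise_scale c (translate g f)"
  by (auto simp: translate_def pointwise_scale_def fun_eq_iff)

lemma induced_subspace: "pointwise.subspace induced"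
proof (rule pointwise.subspaceI)
  have "vec n (0::nat \<Rightarrow> 'f) = 0\<^sub>v n" by auto
  moreover have "\<rho> k *\<^sub>v 0\<^sub>v n = 0\<^sub>v n" if "k \<in> K" for k
    using \<rho>_carrier[OF that] by (auto simp: mult_mat_vec_def scalar_prod_def)
  ultimately show "0 \<in> induced" by (simp add: induced_def)
next
  fix f h assume f: "f \<in> induced" "h \<in> induced"
  have "vec n (a + b) = vec n a + vec n b" for a b :: "nat \<Rightarrow> 'f" by auto
  then show "f + h \<in> induced"
    using f by (auto simp: induced_def mult_add_distrib_mat_vec[OF \<rho>_carrier])
next
  fix c f assume f: "f \<in> induced"
  have "vec n (\<lambda>i. c * a i) = c \<cdot>\<^sub>v vec n a" for a :: "nat \<Rightarrow> 'f" by auto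
  then show "pointwise_scale c f \<in> induced"
    using f by (auto simp: induced_def pointwise_scale_def mult_mat_vec[OF \<rho>_carrier])
qed

lemma translate_induced:
  assumes "f \<in> induced" "g \<in> carrier G"
  shows "translate g f \<in> induced"
  using assms K_closed by (auto simp: induced_def translate_def m_assoc)

lemma translate_averages_to_zero:
  assumes "M \<lhd> G" "averages_to_zero M f" "g \<in> carrier G"
  shows "averages_to_zero M (translate g f)"
  unfolding averages_to_zero_def
proof (intro ballI allI)
  fix x i assume x: "x \<in> carrier G"
  have Mc: "M \<subseteq> carrier G" using assms(1) normal_imp_subgroup subgroup.subset by blast
  have "(\<Sum>m\<in>M. translate g f (x \<otimes> m) i) = (\<Sum>m\<in>M. f (x \<otimes> m \<otimes> g) i)"
    using Mc x by (intro sum.cong) (auto simp: translate_def)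
  also have "\<dots> = (\<Sum>m\<in>M. f (x \<otimes> g \<otimes> m) i)" using normal_sum_conj[OF assms(1) x assms(3)] .
  also have "\<dots> = 0" using assms(2,3) x by (simp add: averages_to_zero_def)
  finally show "(\<Sum>m\<in>M. translate g f (x \<otimes> m) i) = 0" .
qed

lemma card_subgroup_nonzero:
  assumes "subgroup M G"
  shows "of_nat (card M) \<noteq> (0::'f)"
proof
  assume "of_nat (card M) = (0::'f)"
  then have "CHAR('f) dvd card M" by (simp add: of_nat_eq_0_iff_char_dvd)
  moreover have "card M dvd Coset.order G" using lagrange[OF assms] by (metis dvd_triv_right)
  ultimately show False using char_not_dvd dvd_trans by blast
qed

definition average :: "'g set \<Rightarrow> ('g \<Rightarrow> nat \<Rightarrow> 'f) \<Rightarrow> 'g \<Rightarrow> nat \<Rightarrow> 'f" where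
  "average M f = pointwise_scale (inverse (of_nat (card M))) (\<Sum>m\<in>M. translate m f)"

lemma average_apply:
  "x \<in> carrier G \<Longrightarrow> average M f x i = inverse (of_nat (card M)) * (\<Sum>m\<in>M. f (x \<otimes> m) i)"
  "x \<notin> carrier G \<Longrightarrow> average M f x i = 0"
  by (auto simp: average_def pointwise_scale_def sum_fun_apply translate_def)

lemma remove_average:
  assumes M: "subgroup M G"
  shows "averages_to_zero M (f - average M f)"
proof -
  have Mc: "M \<subseteq> carrier G" using M subgroup.subset by blast
  show ?thesis
    unfolding averages_to_zero_def
  proof (intro ballI allI)
    fix x i assume x: "x \<in> carrier G"
    define s where "s = (\<Sum>m\<in>M. f (x \<otimes> m) i)"
    have "average M f (x \<otimes> m) i = inverse (of_nat (card M)) * s" if "m \<in> M" for m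
      using that Mc x subgroup_sum_shift[OF M x that, of "\<lambda>y. f y i"] by (auto simp: average_apply s_def)
    then have "(\<Sum>m\<in>M. average M f (x \<otimes> m) i) = s"
      using card_subgroup_nonzero[OF M] by simp
    then show "(\<Sum>m\<in>M. (f - average M f) (x \<otimes> m) i) = 0"
      by (simp add: sum_subtractf s_def)
  qed
qed

text \<open>By normality of \<open>N\<close>, every translate of \<open>f\<close> averages to zero over \<open>N\<close> as well.\<close>

lemma remove_average_preserves:
  assumes M: "subgroup M G" and N: "N \<lhd> G" "averages_to_zero N f"
  shows "averages_to_zero N (f - average M f)"
proof -
  have Mc: "M \<subseteq> carrier G" and Nc: "N \<subseteq> carrier G"
    using M N normal_imp_subgroup subgroup.subset by blast+
  show ?thesis
    unfolding averages_to_zero_def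
  proof (intro ballI allI)
    fix x i assume x: "x \<in> carrier G"
    have "(\<Sum>a\<in>N. average M f (x \<otimes> a) i) =
        inverse (of_nat (card M)) * (\<Sum>m\<in>M. \<Sum>a\<in>N. f (x \<otimes> a \<otimes> m) i)"
      using Nc x by (subst sum.swap) (simp add: average_apply subset_iff sum_distrib_left)
    also have "(\<Sum>m\<in>M. \<Sum>a\<in>N. f (x \<otimes> a \<otimes> m) i) = (\<Sum>m\<in>M. \<Sum>a\<in>N. f (x \<otimes> m \<otimes> a) i)"
      using Mc x by (intro sum.cong refl normal_sum_conj[OF N(1)]) auto
    also have "\<dots> = 0"
      using N(2) x Mc by (intro sum.neutral) (auto simp: averages_to_zero_def)
    finally show "(\<Sum>m\<in>N. (f - average M f) (x \<otimes> m) i) = 0"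
      using N(2) x by (simp add: sum_subtractf averages_to_zero_def)
  qed
qed

text \<open>Remove averages one obstruction after the other, in an order in which the support never contains the
  next obstruction.  If removing the average over \<open>M\<close> gave zero, then \<open>f\<close> would be constant on the
  cosets of \<open>M\<close>; its support would contain some \<open>x\<close> together with \<open>x \<otimes> m\<close> for all \<open>m \<in> M\<close>, and \<open>M\<close>
  would lie in the subgroup containing the support.\<close>

lemma induced_vector_off_obstructions:
  assumes wit: "\<And>M. M \<in> obstructions \<Longrightarrow> \<exists>z p a. witness M z p a"
    and S: "finite S" "S \<subseteq> obstructions"
  shows "\<exists>f\<in>induced. f \<noteq> 0 \<and> (\<forall>M\<in>S. averages_to_zero M f) \<and>
    (\<forall>x. f x \<noteq> 0 \<longrightarrow> x \<in> generate G (K \<union> \<Union>S))"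
  using S
proof (induction "card S" arbitrary: S)
  case 0
  then have S: "S = {}" by simp
  \<comment> \<open>The function on \<open>K\<close> that corresponds to the first basis vector of \<open>\<rho>\<close>.\<close>
  define f where "f = (\<lambda>x i. if x \<in> K \<and> i < n then \<rho> x $$ (i,0) else 0)"
  have fK: "vec n (f x) = col (\<rho> x) 0" if "x \<in> K" for x
    using \<rho>_carrier[OF that] that n_pos by (auto simp: f_def)
  have "f \<in> induced"
    unfolding induced_def
  proof (safe)
    fix x i assume "x \<notin> carrier G"
    then show "f x i = 0" using K_closed(1) by (auto simp: f_def)
  next
    fix x i assume "n \<le> i"
    then show "f x i = 0" by (simp add: f_def)
  next
    fix k x assume k: "k \<in> K" and x: "x \<in> carrier G"
    show "vec n (f (k \<otimes> x)) = \<rho> k *\<^sub>v vec n (f x)"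
    proof (cases "x \<in> K")
      case True
      then show ?thesis
        using k K_closed(3)[OF k True] col_mult2[OF \<rho>_carrier[OF k] \<rho>_carrier[OF True] n_pos]
        by (simp only: fK \<rho>_mult)
    next
      case False
      have "k \<otimes> x \<notin> K"
      proof
        assume "k \<otimes> x \<in> K"
        then have "inv k \<otimes> (k \<otimes> x) \<in> K" using k K_closed by blast
        then show False using False k x K_closed(1) by (simp add: cancel_inv_left)
      qed
      then have "vec n (f (k \<otimes> x)) = 0\<^sub>v n" "vec n (f x) = 0\<^sub>v n" using False by (auto simp: f_def)
      then show ?thesis using \<rho>_carrier[OF k] by (auto simp: mult_mat_vec_def scalar_prod_def)
    qed
  qed
  moreover have "f \<one> 0 = 1" using \<rho>_one n_pos K_closed(2) by (simp add: f_def)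
  then have "f \<noteq> 0" by auto
  moreover have "x \<in> generate G (K \<union> \<Union>S)" if "f x \<noteq> 0" for x
  proof -
    have "x \<in> K" using that by (auto simp: f_def fun_eq_iff split: if_splits)
    then show ?thesis by (auto intro: generate.incl)
  qed
  ultimately show ?case using S by blast
next
  case (Suc c)
  then have ne: "S \<noteq> {}" by auto
  obtain M where M: "M \<in> S" "\<not> M \<subseteq> generate G (K \<union> \<Union>(S - {M}))"
    using independent_obstruction[OF wit Suc.prems(2) ne Suc.prems(1)] .
  let ?D = "generate G (K \<union> \<Union>(S - {M}))"
  let ?E = "generate G (K \<union> \<Union>S)"
  have "c = card (S - {M})" using Suc.hyps(2) M(1) Suc.prems(1) by simp
  then obtain f where f: "f \<in> induced" "f \<noteq> 0" "\<And>N. N \<in> S - {M} \<Longrightarrow> averages_to_zero N f"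
    "\<And>x. f x \<noteq> 0 \<Longrightarrow> x \<in> ?D"
    using Suc.hyps(1)[of "S - {M}"] Suc.prems finite_Diff[of S "{M}"]
    by (metis Diff_subset subset_trans)
  have sub: "K \<union> \<Union>S \<subseteq> carrier G" using K_closed(1) Suc.prems(2) obstructionD(6) by blast
  have sD: "subgroup ?D G" and sE: "subgroup ?E G"
    using sub by (auto intro!: generate_is_subgroup)
  have DE: "?D \<subseteq> ?E" by (rule mono_generate) blast
  have MO: "M \<in> obstructions" using M(1) Suc.prems(2) by blast
  have sM: "subgroup M G" and Mc: "M \<subseteq> carrier G" using obstructionD(3,6)[OF MO] by auto
  have ME: "M \<subseteq> ?E" using M(1) by (auto intro: generate.incl)
  define h where "h = f - average M f"
  have "average M f \<in> induced"
    unfolding average_def using Mc f(1)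
    by (intro pointwise.subspace_scale[OF induced_subspace] pointwise.subspace_sum[OF induced_subspace]
        translate_induced) auto
  then have "h \<in> induced"
    unfolding h_def using f(1) by (intro pointwise.subspace_diff[OF induced_subspace])
  moreover have "averages_to_zero N h" if "N \<in> S" for N
  proof (cases "N = M")
    case True
    then show ?thesis unfolding h_def using remove_average[OF sM] by simp
  next
    case False
    then show ?thesis
      unfolding h_def using remove_average_preserves[OF sM obstructionD(2) f(3)] that Suc.prems(2) by blast
  qed
  moreover have "h \<noteq> 0"
  proof
    assume "h = 0"
    then have fa: "f = average M f" by (simp add: h_def)
    obtain x where x: "f x \<noteq> 0" using f(2) by (auto simp: fun_eq_iff)
    have xD: "x \<in> ?D" using f(4)[OF x] .
    then have xc: "x \<in> carrier G" using subgroup.mem_carrier[OF sD] by blast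
    have "m \<in> ?D" if m: "m \<in> M" for m
    proof -
      have mc: "m \<in> carrier G" using m Mc by blast
      have "average M f (x \<otimes> m) = average M f x"
        using xc mc subgroup_sum_shift[OF sM xc m] by (auto simp: average_apply fun_eq_iff)
      then have "f (x \<otimes> m) = f x" using fa by simp
      then have "x \<otimes> m \<in> ?D" using f(4) x by simp
      then have "inv x \<otimes> (x \<otimes> m) \<in> ?D"
        using xD sD by (auto intro: subgroup.m_closed subgroup.m_inv_closed)
      then show ?thesis using xc mc by (simp add: cancel_inv_left)
    qed
    then show False using M(2) by blast
  qed
  moreover have "x \<in> ?E" if "h x \<noteq> 0" for x
  proof (rule ccontr)
    assume x: "x \<notin> ?E"
    have f0: "f y = 0" if "y \<notin> ?E" for y using f(4)[of y] DE that by blast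
    have "average M f x i = 0" for i
    proof (cases "x \<in> carrier G")
      case True
      have "x \<otimes> m \<notin> ?E" if m: "m \<in> M" for m
      proof
        assume "x \<otimes> m \<in> ?E"
        then have "(x \<otimes> m) \<otimes> inv m \<in> ?E"
          using m ME sE by (auto intro: subgroup.m_closed subgroup.m_inv_closed)
        then show False using x True m Mc by (auto simp: m_assoc)
      qed
      then show ?thesis using True f0 by (simp add: average_apply)
    qed (simp add: average_apply)
    then have "h x = 0" using f0[OF x] by (auto simp: h_def fun_eq_iff)
    then show False using that by simp
  qed
  ultimately show ?case by blast
qed

text \<open>Frobenius reciprocity: evaluation at \<open>\<one>\<close> commutes with the action of \<open>K\<close>, and it is not zero on \<open>W\<close>
  because any value of a function is the value at \<open>\<one>\<close> of a translate.  Since \<open>\<rho>\<close> is irreducible, its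
  image is everything.\<close>

lemma induced_evaluation_onto:
  assumes W: "W \<subseteq> induced" "pointwise.subspace W" "W \<noteq> {0}" "invariant_under G translate W"
  shows "(\<lambda>w. vec n (w \<one>)) ` W = carrier_vec n"
proof -
  let ?U = "(\<lambda>w. vec n (w \<one>)) ` W"
  have "?U = {0\<^sub>v n} \<or> ?U = carrier_vec n"
  proof (rule invariant_subspace)
    have "vec n ((0 :: 'g \<Rightarrow> nat \<Rightarrow> 'f) \<one>) = 0\<^sub>v n" by auto
    then show "0\<^sub>v n \<in> ?U" using pointwise.subspace_0[OF W(2)] by (metis imageI)
  next
    fix v w assume "v \<in> ?U" "w \<in> ?U"
    then obtain a b where ab: "a \<in> W" "b \<in> W" "v = vec n (a \<one>)" "w = vec n (b \<one>)" by blast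
    then have "v + w = vec n ((a + b) \<one>)" by auto
    then show "v + w \<in> ?U" using pointwise.subspace_add[OF W(2) ab(1,2)] by blast
  next
    fix c w assume "w \<in> ?U"
    then obtain a where a: "a \<in> W" "w = vec n (a \<one>)" by blast
    then have "c \<cdot>\<^sub>v w = vec n (pointwise_scale c a \<one>)" by (auto simp: pointwise_scale_def)
    then show "c \<cdot>\<^sub>v w \<in> ?U" using pointwise.subspace_scale[OF W(2) a(1)] by blast
  next
    fix k w assume k: "k \<in> K" and "w \<in> ?U"
    then obtain a where a: "a \<in> W" "w = vec n (a \<one>)" by blast
    have "\<rho> k *\<^sub>v w = vec n (a (k \<otimes> \<one>))" using a W(1) k by (auto simp: induced_def)
    also have "\<dots> = vec n (translate k a \<one>)" using K_closed(1)[OF k] by (simp add: translate_def)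
    finally show "\<rho> k *\<^sub>v w \<in> ?U" using a W(4) K_closed(1)[OF k] unfolding invariant_under_def by blast
  qed auto
  moreover have "?U \<noteq> {0\<^sub>v n}"
  proof
    assume U: "?U = {0\<^sub>v n}"
    obtain w where w: "w \<in> W" "w \<noteq> 0" using W(3) pointwise.subspace_0[OF W(2)] by blast
    then obtain x i where xi: "w x i \<noteq> 0" by (auto simp: fun_eq_iff)
    have "\<forall>x i. x \<notin> carrier G \<or> n \<le> i \<longrightarrow> w x i = 0" using w(1) W(1) unfolding induced_def by blast
    then have x: "x \<in> carrier G" "i < n" using xi by (blast, metis not_le)
    have "translate x w \<in> W" using W(4) w(1) x(1) by (simp add: invariant_under_def)
    then have "vec n (translate x w \<one>) = 0\<^sub>v n" using U by blast
    then have "translate x w \<one> i = 0" using x(2) by (metis index_vec index_zero_vec(1))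
    then show False using xi x(1) by (simp add: translate_def)
  qed
  ultimately show ?thesis by blast
qed

text \<open>Take an irreducible subspace \<open>W\<close> of the functions that average to zero over all obstructions.  Its kernel
  \<open>N\<close> meets \<open>K\<close> trivially by \<open>induced_evaluation_onto\<close>.  If \<open>N\<close> were nontrivial, it would contain an
  obstruction \<open>M\<close>; then the functions in \<open>W\<close> would be fixed by \<open>M\<close> and average to zero over \<open>M\<close>.\<close>

lemma faithful_irreducible_extension:
  assumes "\<And>M. M \<in> obstructions \<Longrightarrow> \<exists>z\<in>K. z \<notin> center G \<and> central_mod M z"
  obtains m and \<tau> :: "'g \<Rightarrow> 'f mat"
  where "irreducible_representation G m \<tau>" "inj_on \<tau> (carrier G)"
proof -
  have wit: "\<exists>z p a. witness M z p a" if M: "M \<in> obstructions" for M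
  proof -
    obtain z where z: "z \<in> K" "z \<notin> center G" "central_mod M z" using assms[OF M] by blast
    have "z [^] Coset.order G = \<one>" "Coset.order G > 0"
      using K_closed(1)[OF z(1)] finite_carrier order_gt_0_iff_finite by (auto simp: pow_order_eq_1)
    then obtain j p a where j: "z [^] (j::nat) \<notin> center G" "prime (p::nat)" "(z [^] j) [^] (p ^ a) = \<one>"
      using prime_power_part_outside[OF center_subgroup K_closed(1)[OF z(1)]] z(2) by blast
    have "central_mod M (z [^] j)"
      using subgroup_nat_pow_closed[OF central_mod_subgroup[OF obstructionD(2)[OF M]], of z j] z(3) by simp
    then show ?thesis using j K_closed(5)[OF z(1)] unfolding witness_def by blast
  qed
  define V where "V = {f \<in> induced. \<forall>M\<in>obstructions. averages_to_zero M f}"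
  have "obstructions \<subseteq> Pow (carrier G)" using obstructionD(6) by blast
  then have finO: "finite obstructions" using finite_carrier finite_subset by auto
  obtain S :: "('g \<Rightarrow> nat \<Rightarrow> 'f) set" where S: "finite S"
    and span: "\<And>f. (\<And>x i. x \<notin> carrier G \<or> i \<ge> n \<Longrightarrow> f x i = 0) \<Longrightarrow> f \<in> pointwise.span S"
    using finitely_supported_span[OF finite_carrier, of n] by metis
  have indS: "induced \<subseteq> pointwise.span S" using span unfolding induced_def by blast
  have sV: "pointwise.subspace V"
  proof (rule pointwise.subspaceI)
    show "0 \<in> V" using pointwise.subspace_0[OF induced_subspace] by (simp add: V_def averages_to_zero_def)
    show "f + h \<in> V" if "f \<in> V" "h \<in> V" for f h
      using that pointwise.subspace_add[OF induced_subspace]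
      by (simp add: V_def averages_to_zero_def sum.distrib)
    show "pointwise_scale c f \<in> V" if "f \<in> V" for c f
      using that pointwise.subspace_scale[OF induced_subspace]
      by (simp add: V_def averages_to_zero_def pointwise_scale_def sum_distrib_left[symmetric])
  qed
  have "acts_on pointwise_scale G translate V"
    unfolding acts_on_def invariant_under_def
  proof (intro conjI ballI allI sV)
    show "translate g f \<in> V" if "g \<in> carrier G" "f \<in> V" for g f
      using that translate_induced translate_averages_to_zero obstructionD(2) by (auto simp: V_def)
    show "translate \<one> f = f" if "f \<in> V" for f
      using that by (auto simp: V_def induced_def translate_def fun_eq_iff)
    show "translate (g \<otimes> h) f = translate g (translate h f)"
      if "g \<in> carrier G" "h \<in> carrier G" "f \<in> V" for g h f
      using that by (auto simp: translate_def fun_eq_iff m_assoc)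
  qed (auto simp: translate_simps)
  moreover have "V \<noteq> {0}"
    using induced_vector_off_obstructions[OF wit finO] unfolding V_def by blast
  moreover have "V \<subseteq> pointwise.span S" using indS by (auto simp: V_def)
  ultimately obtain W where W: "W \<subseteq> V" "irreducible_action pointwise_scale G translate W"
    using pointwise.irreducible_subaction[OF _ _ S(1), of G translate V] by metis
  have act: "acts_on pointwise_scale G translate W" and W0: "W \<noteq> {0}"
    using W(2) by (auto simp: irreducible_action_def)
  have sW: "pointwise.subspace W" and inv: "invariant_under G translate W"
    using act by (auto simp: acts_on_def)
  have Wi: "W \<subseteq> induced" using W(1) by (auto simp: V_def)
  have actm: "translate (g \<otimes> h) w = translate g (translate h w)" if "g \<in> carrier G" "h \<in> carrier G" "w \<in> W" for g h w
    using act that by (simp add: acts_on_def)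
  have act1: "translate \<one> w = w" if "w \<in> W" for w using act that by (simp add: acts_on_def)
  have inW: "translate g w \<in> W" if "g \<in> carrier G" "w \<in> W" for g w
    using inv that by (simp add: invariant_under_def)
  have WS: "W \<subseteq> pointwise.span S" using Wi indS by blast
  obtain m and \<tau> :: "'g \<Rightarrow> 'f mat" where \<tau>: "irreducible_representation G m \<tau>"
    and \<tau>T: "\<And>g h x. \<lbrakk>g \<in> carrier G; h \<in> carrier G; \<tau> g = \<tau> h; x \<in> W\<rbrakk> \<Longrightarrow> translate g x = translate h x"
    using pointwise.matrix_realization[OF group_axioms W(2) S WS] by metis
  define N where "N = {g \<in> carrier G. \<forall>w\<in>W. translate g w = w}"
  have Nc: "N \<subseteq> carrier G" by (auto simp: N_def)
  have Ninv: "inv g \<in> N" if "g \<in> N" for g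
  proof -
    have "translate (inv g) w = w" if w: "w \<in> W" for w
    proof -
      have "translate (inv g) w = translate (inv g) (translate g w)" using \<open>g \<in> N\<close> w by (simp add: N_def)
      also have "\<dots> = w" using actm[of "inv g" g w] act1[OF w] \<open>g \<in> N\<close> w by (simp add: N_def)
      finally show ?thesis .
    qed
    then show ?thesis using that by (simp add: N_def)
  qed
  have sN: "subgroup N G"
  proof (rule subgroupI[OF Nc _ Ninv])
    have "\<one> \<in> N" using act1 by (simp add: N_def)
    then show "N \<noteq> {}" by blast
    show "x \<otimes> y \<in> N" if "x \<in> N" "y \<in> N" for x y
      using that by (simp add: N_def actm)
  qed
  have nN: "N \<lhd> G"
  proof (rule normal_invI[OF sN])
    fix x h assume x: "x \<in> carrier G" and h: "h \<in> N"
    have "translate (x \<otimes> h \<otimes> inv x) w = w" if w: "w \<in> W" for w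
    proof -
      have "translate (x \<otimes> h \<otimes> inv x) w = translate x (translate h (translate (inv x) w))"
        using x h w inW by (simp add: actm N_def)
      also have "\<dots> = translate x (translate (inv x) w)" using x h w inW by (simp add: N_def)
      also have "\<dots> = w" using actm[of x "inv x" w] act1[OF w] x w by simp
      finally show ?thesis .
    qed
    then show "x \<otimes> h \<otimes> inv x \<in> N" using x h by (simp add: N_def)
  qed
  have NK: "N \<inter> K = {\<one>}"
  proof -
    have "k = \<one>" if k: "k \<in> N" "k \<in> K" for k
    proof (rule trivial_if_fixes_all[OF k(2)])
      fix v :: "'f vec" assume "v \<in> carrier_vec n"
      then obtain w where w: "w \<in> W" "v = vec n (w \<one>)"
        using induced_evaluation_onto[OF Wi sW W0 inv] by blast
      have "\<rho> k *\<^sub>v v = vec n (w (k \<otimes> \<one>))" using w Wi k by (auto simp: induced_def)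
      also have "w (k \<otimes> \<one>) = translate k w \<one>" using K_closed(1)[OF k(2)] by (simp add: translate_def)
      also have "\<dots> = w \<one>" using k(1) w(1) by (simp add: N_def)
      finally show "\<rho> k *\<^sub>v v = v" using w by simp
    qed
    then show ?thesis using subgroup.one_closed[OF sN] K_closed(2) by blast
  qed
  have N1: "N = {\<one>}"
  proof (rule ccontr)
    assume "N \<noteq> {\<one>}"
    then obtain M where M: "minimal_normal M" "M \<subseteq> N"
      using minimal_normal_exists[OF finite_carrier nN] by blast
    have sM: "subgroup M G" using M(1) by (simp add: minimal_normal_def normal_imp_subgroup)
    have "M \<inter> K = {\<one>}" using M(2) NK subgroup.one_closed[OF sM] K_closed(2) by blast
    then have MO: "M \<in> obstructions" using M(1) by (simp add: obstructions_def)
    have "w = 0" if w: "w \<in> W" for w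
    proof -
      have "w x i = 0" for x i
      proof (cases "x \<in> carrier G")
        case True
        have "w (x \<otimes> m) i = w x i" if "m \<in> M" for m
        proof -
          have "translate m w = w" using that M(2) w by (auto simp: N_def)
          then have "translate m w x = w x" by simp
          then show ?thesis using True by (simp add: translate_def)
        qed
        then have "of_nat (card M) * w x i = (\<Sum>m\<in>M. w (x \<otimes> m) i)" by simp
        also have "\<dots> = 0" using w W(1) MO True by (auto simp: V_def averages_to_zero_def)
        finally show ?thesis using card_subgroup_nonzero[OF sM] by simp
      next
        case False
        then show ?thesis using w Wi by (auto simp: induced_def)
      qed
      then show ?thesis by (simp add: fun_eq_iff)
    qed
    then show False using W0 pointwise.subspace_0[OF sW] by blast
  qed
  have "inj_on \<tau> (carrier G)"
  proof (rule inj_onI)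
    fix g h assume gh: "g \<in> carrier G" "h \<in> carrier G" "\<tau> g = \<tau> h"
    have "translate (inv h \<otimes> g) w = w" if w: "w \<in> W" for w
    proof -
      have "translate (inv h \<otimes> g) w = translate (inv h) (translate h w)"
        using gh w \<tau>T[OF gh w] by (simp add: actm)
      also have "\<dots> = w" using actm[of "inv h" h w] act1[OF w] gh w by simp
      finally show ?thesis .
    qed
    then have "inv h \<otimes> g \<in> N" using gh by (simp add: N_def)
    then have "inv h \<otimes> g = \<one>" using N1 by simp
    then show "g = h" using gh by (metis inv_closed inv_equality inv_inv)
  qed
  then show ?thesis using that \<tau> by blast
qed

end

section \<open>Passage to a quotient, and the equivalence\<close>

lemma transport_to_image:
  fixes H :: "('h, 'k) monoid_scheme" and L :: "('g, 'm) monoid_scheme" and \<rho> :: "'h \<Rightarrow> 'f::field mat"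
  assumes H: "group H" and L: "group L" and j: "j \<in> hom H L" "inj_on j (carrier H)"
    and \<rho>: "irreducible_representation H n \<rho>" "inj_on \<rho> (carrier H)"
  obtains \<rho>' :: "'g \<Rightarrow> 'f mat" where "irreducible_representation (L\<lparr>carrier := j ` carrier H\<rparr>) n \<rho>'" "inj_on \<rho>' (j ` carrier H)"
proof -
  interpret group_hom H L j using H L j(1) by (simp add: group_hom_def group_hom_axioms_def)
  let ?K = "L\<lparr>carrier := j ` carrier H\<rparr>"
  let ?i = "inv_into (carrier H) j"
  have K: "group ?K" using img_is_subgroup by (rule H.subgroup_imp_group)
  have "j \<in> iso H ?K" using j by (auto simp: iso_def bij_betw_def hom_def)
  then have i: "?i \<in> iso ?K H" by (rule G.iso_set_sym)
  then have "irreducible_representation ?K n (\<rho> \<circ> ?i)"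
    by (intro irreducible_representation_pullback[OF K H _ _ \<rho>(1)]) (auto simp: iso_def bij_betw_def)
  moreover have "inj_on (\<rho> \<circ> ?i) (j ` carrier H)"
    using i \<rho>(2) by (intro comp_inj_on) (auto simp: iso_def bij_betw_def)
  ultimately show ?thesis using that by blast
qed

text \<open>The choice of \<open>R\<close> makes \<open>faithful_irreducible_extension\<close> applicable to \<open>L = G/R\<close>: the preimage \<open>R'\<close> of an
  obstruction in \<open>L\<close> is strictly larger than \<open>R\<close> and still meets the image of \<open>H\<close> trivially, so by maximality
  some \<open>z\<close> in that image, but outside the center of \<open>G\<close>, is central modulo \<open>R'\<close>, while \<open>z\<close> is not central modulo \<open>R\<close>.\<close>

lemma center_preserving_extension:
  fixes H :: "('h, 'k) monoid_scheme" and G :: "('g, 'm) monoid_scheme" and \<rho> :: "'h \<Rightarrow> 'f::field mat"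
  assumes H: "group H" and \<rho>: "irreducible_representation H n \<rho>" "inj_on \<rho> (carrier H)"
    and G: "group G" "finite (carrier G)" "\<not> CHAR('f) dvd Coset.order G"
    and \<iota>: "\<iota> \<in> hom H G" "inj_on \<iota> (carrier H)"
  shows "\<exists>m (\<sigma> :: 'g \<Rightarrow> 'f mat). irreducible_representation G m \<sigma> \<and> inj_on (\<sigma> \<circ> \<iota>) (carrier H) \<and>
    center_preserving_on G (GL TYPE('f) m) \<sigma> (\<iota> ` carrier H)"
proof -
  interpret G: group G by fact
  interpret \<iota>: group_hom H G \<iota> using H G \<iota>(1) by (simp add: group_hom_def group_hom_axioms_def)
  let ?K = "\<iota> ` carrier H"
  let ?com = "\<lambda>g z. g \<otimes>\<^bsub>G\<^esub> z \<otimes>\<^bsub>G\<^esub> inv\<^bsub>G\<^esub> g \<otimes>\<^bsub>G\<^esub> inv\<^bsub>G\<^esub> z"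
  have sK: "subgroup ?K G" by (rule \<iota>.img_is_subgroup)
  have Kc: "?K \<subseteq> carrier G" using sK by (rule subgroup.subset)
  define good where "good R \<longleftrightarrow> R \<lhd> G \<and> R \<inter> ?K = {\<one>\<^bsub>G\<^esub>} \<and> (\<forall>z\<in>?K. G.central_mod R z \<longrightarrow> z \<in> center G)" for R
  have "good {\<one>\<^bsub>G\<^esub>}"
    using subgroup.one_closed[OF sK] G.one_is_normal G.in_center_iff unfolding good_def by blast
  moreover have "finite {R. good R}"
  proof (rule finite_subset)
    show "{R. good R} \<subseteq> Pow (carrier G)"
      unfolding good_def using normal_imp_subgroup subgroup.subset by blast
  qed (use G(2) in simp)
  ultimately obtain R where R: "good R" and max: "\<And>R'. good R' \<Longrightarrow> R \<subseteq> R' \<Longrightarrow> R = R'"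
    using finite_has_maximal[of "{R. good R}"] by auto
  have nR: "R \<lhd> G" and RK: "R \<inter> ?K = {\<one>\<^bsub>G\<^esub>}"
    and RZ: "\<And>z. z \<in> ?K \<Longrightarrow> G.central_mod R z \<Longrightarrow> z \<in> center G"
    using R by (auto simp: good_def)
  interpret R: normal R G by (rule nR)
  define L where "L = G Mod R"
  define \<pi> where "\<pi> g = R #>\<^bsub>G\<^esub> g" for g
  have L: "group L" unfolding L_def by (rule R.factorgroup_is_group)
  interpret L: group L by (rule L)
  have \<pi>h: "\<pi> \<in> hom G L" unfolding \<pi>_def[abs_def] L_def by (rule R.r_coset_hom_Mod)
  interpret \<pi>: group_hom G L \<pi> using G(1) L \<pi>h by (simp add: group_hom_def group_hom_axioms_def)
  have \<pi>s: "\<pi> ` carrier G = carrier L" by (auto simp: \<pi>_def L_def FactGroup_def RCOSETS_def)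
  have \<pi>1: "\<pi> g = \<one>\<^bsub>L\<^esub> \<longleftrightarrow> g \<in> R" if "g \<in> carrier G" for g
    using G.coset_join1[OF _ that R.subgroup_axioms] G.coset_join2[OF that R.subgroup_axioms]
    by (auto simp: \<pi>_def L_def FactGroup_def)
  have \<pi>com: "\<pi> (?com g z) = \<pi> g \<otimes>\<^bsub>L\<^esub> \<pi> z \<otimes>\<^bsub>L\<^esub> inv\<^bsub>L\<^esub> \<pi> g \<otimes>\<^bsub>L\<^esub> inv\<^bsub>L\<^esub> \<pi> z"
    if "g \<in> carrier G" "z \<in> carrier G" for g z
    using that by simp
  have finL: "finite (carrier L)" using G(2) \<pi>s by (metis finite_imageI)
  have "\<not> CHAR('f) dvd Coset.order L"
  proof
    assume "CHAR('f) dvd Coset.order L"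
    moreover have "Coset.order L dvd Coset.order G"
      using G.lagrange[OF R.subgroup_axioms] by (metis L_def FactGroup_def Coset.order_def partial_object.select_convs(1) dvd_triv_left)
    ultimately show False using G(3) dvd_trans by blast
  qed
  moreover define j where "j = \<pi> \<circ> \<iota>"
  have jh: "j \<in> hom H L" unfolding j_def using \<iota>(1) \<pi>h by (rule hom_compose)
  have ji: "inj_on j (carrier H)"
  proof -
    have "\<pi> x = \<pi> y \<Longrightarrow> x = y" if x: "x \<in> ?K" and y: "y \<in> ?K" for x y
    proof -
      assume eq: "\<pi> x = \<pi> y"
      have c: "x \<in> carrier G" "y \<in> carrier G" using x y Kc by auto
      have "\<pi> (x \<otimes>\<^bsub>G\<^esub> inv\<^bsub>G\<^esub> y) = \<one>\<^bsub>L\<^esub>" using eq c by simp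
      then have "x \<otimes>\<^bsub>G\<^esub> inv\<^bsub>G\<^esub> y \<in> R"
        using \<pi>1[of "x \<otimes>\<^bsub>G\<^esub> inv\<^bsub>G\<^esub> y"] c by simp
      moreover have "x \<otimes>\<^bsub>G\<^esub> inv\<^bsub>G\<^esub> y \<in> ?K"
        using sK x y by (auto intro: subgroup.m_closed subgroup.m_inv_closed)
      ultimately have "x \<otimes>\<^bsub>G\<^esub> inv\<^bsub>G\<^esub> y = \<one>\<^bsub>G\<^esub>" using RK by blast
      then show "x = y" using c by (metis G.inv_closed G.inv_equality G.inv_inv)
    qed
    then have "inj_on \<pi> ?K" by (rule inj_onI)
    then show ?thesis unfolding j_def using \<iota>(2) by (intro comp_inj_on)
  qed
  have sj: "subgroup (j ` carrier H) L"
  proof -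
    interpret group_hom H L j using H L jh by (simp add: group_hom_def group_hom_axioms_def)
    show ?thesis by (rule img_is_subgroup)
  qed
  moreover obtain \<rho>' :: "'g set \<Rightarrow> 'f mat"
    where "irreducible_representation (L\<lparr>carrier := j ` carrier H\<rparr>) n \<rho>'" "inj_on \<rho>' (j ` carrier H)"
    using transport_to_image[OF H L jh ji \<rho>] .
  ultimately interpret L: faithful_irreducible_on_subgroup L "j ` carrier H" n \<rho>'
    using L finL by (simp add: faithful_irreducible_on_subgroup_def faithful_irreducible_on_subgroup_axioms_def)
  have "\<exists>z\<in>j ` carrier H. z \<notin> center L \<and> L.central_mod M z" if M: "M \<in> L.obstructions" for M
  proof -
    have nM: "M \<lhd> L" and sM: "subgroup M L" using L.obstructionD(2,3)[OF M] .
    define R' where "R' = {g \<in> carrier G. \<pi> g \<in> M}"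
    have sR': "subgroup R' G"
    proof (rule G.subgroupI)
      have "\<one>\<^bsub>G\<^esub> \<in> R'" using subgroup.one_closed[OF sM] by (simp add: R'_def)
      then show "R' \<noteq> {}" by blast
    qed (auto simp: R'_def subgroup.m_closed[OF sM] subgroup.m_inv_closed[OF sM])
    have nR': "R' \<lhd> G"
      by (rule G.normal_invI[OF sR']) (auto simp: R'_def L.normal_invE(2)[OF nM])
    have "R \<subseteq> R'"
    proof
      fix g assume "g \<in> R"
      then have "g \<in> carrier G" "\<pi> g = \<one>\<^bsub>L\<^esub>" using \<pi>1[of g] by auto
      then show "g \<in> R'" using subgroup.one_closed[OF sM] by (simp add: R'_def)
    qed
    moreover have "R \<noteq> R'"
    proof
      assume eq: "R = R'"
      have "X = \<one>\<^bsub>L\<^esub>" if X: "X \<in> M" for X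
      proof -
        obtain g where g: "g \<in> carrier G" "X = \<pi> g"
          using X L.obstructionD(6)[OF M] \<pi>s by blast
        then have "g \<in> R'" using X unfolding R'_def by blast
        then have "g \<in> R" unfolding eq .
        then show ?thesis using \<pi>1[OF g(1)] g(2) by blast
      qed
      then have "M = {\<one>\<^bsub>L\<^esub>}" using subgroup.one_closed[OF sM] by blast
      then show False using L.obstructionD(5)[OF M] by blast
    qed
    ultimately have "\<not> good R'" using max by blast
    moreover have "R' \<inter> ?K = {\<one>\<^bsub>G\<^esub>}"
    proof -
      have "g = \<one>\<^bsub>G\<^esub>" if g: "g \<in> R'" "g \<in> ?K" for g
      proof -
        have "\<pi> g \<in> M \<inter> j ` carrier H" using g by (auto simp: R'_def j_def)
        then have "\<pi> g = \<one>\<^bsub>L\<^esub>" using L.obstructionD(4)[OF M] by blast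
        then have "g \<in> R" using \<pi>1 g(2) Kc by blast
        then show ?thesis using RK g(2) by blast
      qed
      then show ?thesis using subgroup.one_closed[OF sK] subgroup.one_closed[OF sR'] by blast
    qed
    ultimately obtain z where z: "z \<in> ?K" "G.central_mod R' z" "z \<notin> center G"
      using nR' unfolding good_def by blast
    have zc: "z \<in> carrier G" using z(1) Kc by blast
    have "\<pi> z \<notin> center L"
    proof
      assume "\<pi> z \<in> center L"
      then have c: "L.central_mod {\<one>\<^bsub>L\<^esub>} (\<pi> z)" using L.in_center_iff by blast
      have "?com g z \<in> R" if g: "g \<in> carrier G" for g
      proof -
        have "\<pi> (?com g z) = \<one>\<^bsub>L\<^esub>"
          using c \<pi>com[OF g zc] \<pi>.hom_closed[OF g] by (simp add: L.central_mod_def)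
        then show ?thesis using \<pi>1[of "?com g z"] g zc by simp
      qed
      then have "G.central_mod R z" using zc by (simp add: G.central_mod_def)
      then show False using RZ[OF z(1)] z(3) by blast
    qed
    moreover have "L.central_mod M (\<pi> z)"
      unfolding L.central_mod_def
    proof (intro conjI ballI)
      show "\<pi> z \<in> carrier L" using zc by simp
      fix X assume "X \<in> carrier L"
      then obtain g where g: "g \<in> carrier G" "X = \<pi> g" using \<pi>s by blast
      have "?com g z \<in> R'" using z(2) g by (simp add: G.central_mod_def)
      then have "\<pi> (?com g z) \<in> M" unfolding R'_def by blast
      then show "X \<otimes>\<^bsub>L\<^esub> \<pi> z \<otimes>\<^bsub>L\<^esub> inv\<^bsub>L\<^esub> X \<otimes>\<^bsub>L\<^esub> inv\<^bsub>L\<^esub> \<pi> z \<in> M"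
        unfolding \<pi>com[OF g(1) zc] g(2) .
    qed
    moreover have "\<pi> z \<in> j ` carrier H" using z(1) by (auto simp: j_def)
    ultimately show ?thesis by blast
  qed
  then obtain m and \<tau> :: "'g set \<Rightarrow> 'f mat"
    where \<tau>: "irreducible_representation L m \<tau>" "inj_on \<tau> (carrier L)"
    using L.faithful_irreducible_extension by blast
  define \<sigma> where "\<sigma> = \<tau> \<circ> \<pi>"
  have \<sigma>: "irreducible_representation G m \<sigma>"
    unfolding \<sigma>_def using irreducible_representation_pullback[OF G(1) L \<pi>h \<pi>s \<tau>(1)] .
  have "inj_on (\<tau> \<circ> j) (carrier H)"
    using ji \<tau>(2) jh by (intro comp_inj_on) (auto intro: inj_on_subset simp: hom_def)
  then have "inj_on (\<sigma> \<circ> \<iota>) (carrier H)" by (simp add: \<sigma>_def j_def comp_assoc)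
  moreover have "center_preserving_on G (GL TYPE('f) m) \<sigma> ?K"
    unfolding center_preserving_on_def
  proof
    fix h assume h: "h \<in> hom_center G (GL TYPE('f) m) \<sigma> \<inter> ?K"
    then have hc: "h \<in> carrier G" and hK: "h \<in> ?K" using Kc by auto
    have "?com g h \<in> R" if g: "g \<in> carrier G" for g
    proof -
      have "\<sigma> h * \<sigma> g = \<sigma> g * \<sigma> h"
        using h g by (auto simp: hom_center_def center_def GL_def units_of_def ring_mat_simps)
      moreover have "\<forall>x\<in>carrier G. \<forall>y\<in>carrier G. \<sigma> (x \<otimes>\<^bsub>G\<^esub> y) = \<sigma> x * \<sigma> y"
        using \<sigma> representation_iff[OF G(1)] by (auto simp: irreducible_representation_def)
      ultimately have "\<tau> (\<pi> (g \<otimes>\<^bsub>G\<^esub> h)) = \<tau> (\<pi> (h \<otimes>\<^bsub>G\<^esub> g))"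
        using g hc by (simp add: \<sigma>_def)
      then have "\<pi> (g \<otimes>\<^bsub>G\<^esub> h) = \<pi> (h \<otimes>\<^bsub>G\<^esub> g)"
        using \<tau>(2) g hc by (meson G.m_closed \<pi>.hom_closed inj_onD)
      then have "\<pi> g \<otimes>\<^bsub>L\<^esub> \<pi> h = \<pi> h \<otimes>\<^bsub>L\<^esub> \<pi> g" using g hc by simp
      then have "\<pi> (?com g h) = \<one>\<^bsub>L\<^esub>"
        unfolding \<pi>com[OF g hc] using L.commutator_one_iff \<pi>.hom_closed g hc by blast
      then show ?thesis using \<pi>1[of "?com g h"] g hc by simp
    qed
    then have "G.central_mod R h" using hc by (simp add: G.central_mod_def)
    then show "h \<in> center G" using RZ[OF hK] by blast
  qed
  ultimately show ?thesis using \<sigma> by blast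
qed

theorem corollary1p3:
  fixes H :: "('h, 'm) monoid_scheme"
  assumes "group H" and "finite (carrier H)"
    and "\<not> CHAR('f::field) dvd Coset.order H"
    and "infinite (UNIV :: 'g set)"
  shows "(\<exists>n (\<rho> :: 'h \<Rightarrow> 'f mat).
            irreducible_representation H n \<rho> \<and> inj_on \<rho> (carrier H))
     \<longleftrightarrow>
         (\<forall>(G :: 'g monoid) \<iota>.
            group G \<and> finite (carrier G) \<and> \<not> CHAR('f) dvd Coset.order G \<and>
            \<iota> \<in> hom H G \<and> inj_on \<iota> (carrier H) \<longrightarrow>
            (\<exists>n (\<sigma> :: 'g \<Rightarrow> 'f mat).
               irreducible_representation G n \<sigma> \<and>
               inj_on (\<sigma> \<circ> \<iota>) (carrier H) \<and>
               center_preserving_on G (GL TYPE('f) n) \<sigma> (\<iota> ` carrier H)))"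
    (is "?faithful \<longleftrightarrow> ?extends")
proof
  assume ?faithful
  then show ?extends using center_preserving_extension[OF assms(1)] by blast
next
  assume ext: ?extends
  obtain B :: "'g set" where B: "finite B" "card B = card (carrier H)"
    using infinite_arbitrarily_large[OF assms(4)] by blast
  then obtain f :: "'h \<Rightarrow> 'g" where "bij_betw f (carrier H) B"
    using finite_same_card_bij[OF assms(2) B(1)] by auto
  then have f: "inj_on f (carrier H)" by (simp add: bij_betw_def)
  define G where "G = image_group f H"
  have iso: "f \<in> iso H G" unfolding G_def using f by (rule inj_imp_image_group_iso)
  have G: "group G" unfolding G_def using assms(1) f by (rule group.inj_imp_image_group_is_group)
  have fc: "f ` carrier H = carrier G" by (simp add: G_def image_group_carrier)
  have "Coset.order G = Coset.order H" using f by (simp add: Coset.order_def fc[symmetric] card_image)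
  moreover have "finite (carrier G)" using assms(2) fc by (metis finite_imageI)
  moreover have fh: "f \<in> hom H G" using iso by (simp add: iso_def)
  ultimately obtain n and \<sigma> :: "'g \<Rightarrow> 'f mat"
    where \<sigma>: "irreducible_representation G n \<sigma>" "inj_on (\<sigma> \<circ> f) (carrier H)"
    using ext[rule_format, of G f] G f assms(3) by auto
  have "irreducible_representation H n (\<sigma> \<circ> f)"
    using irreducible_representation_pullback[OF assms(1) G fh fc \<sigma>(1)] .
  then show ?faithful using \<sigma>(2) by blast
qed

end
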